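(* Let $R$ be a unital ring such that $K_0(R)$ is a finitely generated abelian group and the element $[1_R]\in K_0(R)$ has infinite order. Then $R$ has Invariant Matrix Number, i.e. ${\rm M}_i(R)\not\cong {\rm M}_j(R)$ (as rings) for every pair of positive integers $i\neq j$. In particular, if $k$ is a field and $E$ is a finite directed graph such that $[1_{L(E)}]$ has infinite order in $K_0(L(E))$, where $L(E)=L_k(E)$ is the Leavitt path algebra, then $L(E)$ has Invariant Matrix Number.
   Context: $K_0(R)$ denotes the Grothendieck group of finitely generated projective right $R$-modules, and $[1_R]$ is the class of the regular module $R_R$. ${\rm M}_i(R)$ denotes the ring of $i\times i$ matrices over $R$. A finite directed graph $E=(E^0,E^1,r,s)$ has finitely many vertices $E^0$ and edges $E^1$, with range and source maps $r,s:E^1\to E^0$. For a field $k$, the Leavitt path algebra $L_k(E)$ is the $k$-algebra generated by $\{v : v\in E^0\}\cup\{e,e^* : e\in E^1\}$ subject to the relations: $vw=\delta_{v,w}v$ for $v,w\in E^0$; $s(e)e=e=er(e)$ and $r(e)e^*=e^*=e^*s(e)$ for $e\in E^1$; $e^*f=\delta_{e,f}r(e)$ for $e,f\in E^1$; and $v=\sum_{e\in E^1,\,s(e)=v}ee^*$ for every vertex $v$ that emits at least one edge. It is unital with $1=\sum_{v\in E^0}v$ when $E$ is finite. *)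

theory Defs
  imports "Jordan_Normal_Form.Matrix" "HOL-Algebra.Generated_Groups" "HOL-Algebra.QuotRing"
begin

text \<open>K_0 of a unital ring R (a type of class ring_1), via the standard description by
  idempotent square matrices: finitely generated projective right R-modules correspond
  to idempotent matrices P (module P R^n); isomorphism of modules is Murray-von Neumann
  equivalence of idempotents; direct sum is block-diagonal sum. K_0(R) is the
  Grothendieck group of the resulting commutative monoid V(R).\<close>

definition idem_mat :: "'a::ring_1 mat \<Rightarrow> bool" where
  "idem_mat P \<longleftrightarrow> P \<in> carrier_mat (dim_row P) (dim_row P) \<and> P * P = P"

definition mvn_equiv :: "'a::ring_1 mat \<Rightarrow> 'a mat \<Rightarrow> bool" where
  "mvn_equiv P Q \<longleftrightarrow> (\<exists>X Y. X \<in> carrier_mat (dim_row P) (dim_row Q) \<and>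
      Y \<in> carrier_mat (dim_row Q) (dim_row P) \<and> X * Y = P \<and> Y * X = Q)"

definition dsum :: "'a::ring_1 mat \<Rightarrow> 'a mat \<Rightarrow> 'a mat" where
  "dsum P Q = four_block_mat P (0\<^sub>m (dim_row P) (dim_col Q)) (0\<^sub>m (dim_row Q) (dim_col P)) Q"

text \<open>Pairs (P,Q) represent formal differences [P] - [Q].\<close>
definition K0_pairs :: "'a::ring_1 itself \<Rightarrow> ('a mat \<times> 'a mat) set" where
  "K0_pairs ty = {(P, Q). idem_mat P \<and> idem_mat Q}"

definition K0_rel :: "'a::ring_1 itself \<Rightarrow> (('a mat \<times> 'a mat) \<times> ('a mat \<times> 'a mat)) set" where
  "K0_rel ty = {((P, Q), (P', Q')). (P, Q) \<in> K0_pairs ty \<and> (P', Q') \<in> K0_pairs ty \<and>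
      (\<exists>S. idem_mat S \<and> mvn_equiv (dsum (dsum P Q') S) (dsum (dsum P' Q) S))}"

definition K0_class :: "'a::ring_1 itself \<Rightarrow> 'a mat \<times> 'a mat \<Rightarrow> ('a mat \<times> 'a mat) set" where
  "K0_class ty x = K0_rel ty `` {x}"

definition K0 :: "'a::ring_1 itself \<Rightarrow> ('a mat \<times> 'a mat) set monoid" where
  "K0 ty = \<lparr> carrier = K0_pairs ty // K0_rel ty,
            mult = (\<lambda>A B. let a = (SOME a. a \<in> A); b = (SOME b. b \<in> B)
                          in K0_class ty (dsum (fst a) (fst b), dsum (snd a) (snd b))),
            one = K0_class ty (0\<^sub>m 0 0, 0\<^sub>m 0 0) \<rparr>"

definition K0_unit :: "'a::ring_1 itself \<Rightarrow> ('a mat \<times> 'a mat) set" where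
  "K0_unit ty = K0_class ty (1\<^sub>m 1, 0\<^sub>m 0 0)"

definition invariant_matrix_number :: "'a::ring_1 itself \<Rightarrow> bool" where
  "invariant_matrix_number ty \<longleftrightarrow>
     (\<forall>i j::nat. 0 < i \<longrightarrow> 0 < j \<longrightarrow> i \<noteq> j \<longrightarrow>
        \<not> is_ring_iso (ring_mat ty i ()) (ring_mat ty j ()))"

end

theory Submission
  imports Defs "HOL-Library.Product_Plus"
begin

text \<open>An isomorphism \<open>f : M\<^sub>i(R) \<cong> M\<^sub>j(R)\<close> restricts to the non-unital corner embedding
  \<open>a \<mapsto> f(a E\<^sub>0\<^sub>0)\<close> of \<open>R\<close> into \<open>M\<^sub>j(R)\<close>, which induces an endomorphism \<open>\<tau>\<close> of \<open>K\<^sub>0(R)\<close>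
  with \<open>\<tau>(i[1]) = j[1]\<close>: \<open>f(1) = 1\<close> is a sum of \<open>i\<close> orthogonal idempotents, each equivalent to
  \<open>f(E\<^sub>0\<^sub>0)\<close>. The inverse isomorphism gives \<open>\<sigma>(j[1]) = i[1]\<close>.
  Since \<open>[1]\<close> has infinite order and \<open>K\<^sub>0(R)\<close> is finitely generated, there is a homomorphism
  \<open>\<psi> : K\<^sub>0(R) \<rightarrow> \<rat>\<close> with \<open>\<psi>[1] = 1\<close> whose values have denominators dividing some \<open>d\<close>.
  From \<open>i\<^sup>n \<tau>\<^sup>n[1] = j\<^sup>n [1]\<close> we get \<open>i\<^sup>n \<psi>(\<tau>\<^sup>n[1]) = j\<^sup>n\<close>, so \<open>i\<^sup>n\<close> divides \<open>d j\<^sup>n\<close> for all \<open>n\<close>;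
  together with the symmetric statement this forces \<open>i = j\<close>.\<close>

section \<open>Block sums and Murray--von Neumann equivalence\<close>

lemma idem_matD:
  assumes "idem_mat P"
  shows "P \<in> carrier_mat (dim_row P) (dim_row P)" "P * P = P"
  using assms by (auto simp: idem_mat_def)

lemma idem_mat_zero: "idem_mat (0\<^sub>m 0 0 :: 'a::ring_1 mat)"
  by (simp add: idem_mat_def)

lemma idem_mat_one: "idem_mat (1\<^sub>m n :: 'a::ring_1 mat)"
  by (simp add: idem_mat_def)

lemma dsum_carrier_mat:
  "P \<in> carrier_mat a b \<Longrightarrow> Q \<in> carrier_mat c d \<Longrightarrow> dsum P Q \<in> carrier_mat (a + c) (b + d)"
  by (auto simp: dsum_def)

lemma dim_dsum [simp]:
  "dim_row (dsum P Q) = dim_row P + dim_row Q"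
  "dim_col (dsum P Q) = dim_col P + dim_col Q"
  by (auto simp: dsum_def)

lemma index_dsum:
  assumes "i < dim_row P + dim_row Q" "j < dim_col P + dim_col Q"
  shows "dsum P Q $$ (i, j) =
    (if i < dim_row P then if j < dim_col P then P $$ (i, j) else 0
     else if j < dim_col P then 0 else Q $$ (i - dim_row P, j - dim_col P))"
  using assms by (simp add: dsum_def four_block_mat_def Let_def del: if_split)

lemma index_dsum_UL: "i < dim_row P \<Longrightarrow> j < dim_col P \<Longrightarrow> dsum P Q $$ (i, j) = P $$ (i, j)"
  by (subst index_dsum) auto

lemma index_dsum_UR:
  "i < dim_row P \<Longrightarrow> \<not> j < dim_col P \<Longrightarrow> j < dim_col P + dim_col Q \<Longrightarrow> dsum P Q $$ (i, j) = 0"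
  by (subst index_dsum) auto

lemma index_dsum_LL:
  "\<not> i < dim_row P \<Longrightarrow> i < dim_row P + dim_row Q \<Longrightarrow> j < dim_col P \<Longrightarrow> dsum P Q $$ (i, j) = 0"
  by (subst index_dsum) auto

lemma index_dsum_LR:
  "\<not> i < dim_row P \<Longrightarrow> i < dim_row P + dim_row Q \<Longrightarrow> \<not> j < dim_col P \<Longrightarrow> j < dim_col P + dim_col Q \<Longrightarrow>
    dsum P Q $$ (i, j) = Q $$ (i - dim_row P, j - dim_col P)"
  by (subst index_dsum) auto

lemmas index_dsum_blocks = index_dsum_UL index_dsum_UR index_dsum_LL index_dsum_LR

lemma dsum_mult:
  assumes "A \<in> carrier_mat a b" "B \<in> carrier_mat b c" "C \<in> carrier_mat d e" "D \<in> carrier_mat e f"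
  shows "dsum A C * dsum B D = dsum (A * B) (C * D)"
proof -
  have dims: "dim_row A = a" "dim_col A = b" "dim_row B = b" "dim_col B = c"
    "dim_row C = d" "dim_col C = e" "dim_row D = e" "dim_col D = f"
    using assms by auto
  show ?thesis
    unfolding dsum_def dims using assms
    by (subst mult_four_block_mat[OF assms(1) zero_carrier_mat zero_carrier_mat assms(3)
          assms(2) zero_carrier_mat zero_carrier_mat assms(4)]) auto
qed

lemma dsum_assoc: "dsum (dsum P Q) R = dsum P (dsum Q R)"
proof (rule eq_matI)
  fix i j assume "i < dim_row (dsum P (dsum Q R))" "j < dim_col (dsum P (dsum Q R))"
  then show "dsum (dsum P Q) R $$ (i, j) = dsum P (dsum Q R) $$ (i, j)"
    by (cases "i < dim_row P"; cases "i < dim_row P + dim_row Q";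
        cases "j < dim_col P"; cases "j < dim_col P + dim_col Q") (simp_all add: index_dsum_blocks)
qed auto

lemma dsum_zero_left: "dsum (0\<^sub>m 0 0) P = P"
  by (rule eq_matI) (auto simp: index_dsum_blocks)

lemma idem_mat_dsum:
  assumes "idem_mat P" "idem_mat Q"
  shows "idem_mat (dsum P Q)"
proof -
  note P = idem_matD[OF assms(1)] and Q = idem_matD[OF assms(2)]
  have "dsum P Q * dsum P Q = dsum P Q"
    using dsum_mult[OF P(1) P(1) Q(1) Q(1)] P(2) Q(2) by simp
  then show ?thesis
    using dsum_carrier_mat[OF P(1) Q(1)] by (simp add: idem_mat_def)
qed

lemma mvn_equivI:
  assumes "X \<in> carrier_mat (dim_row P) (dim_row Q)" "Y \<in> carrier_mat (dim_row Q) (dim_row P)"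
    and "X * Y = P" "Y * X = Q"
  shows "mvn_equiv P Q"
  using assms unfolding mvn_equiv_def by blast

lemma mvn_equiv_refl: "idem_mat P \<Longrightarrow> mvn_equiv P P"
  unfolding mvn_equiv_def idem_mat_def by auto

lemma mvn_equiv_sym: "mvn_equiv P Q \<Longrightarrow> mvn_equiv Q P"
  unfolding mvn_equiv_def by auto

text \<open>With \<open>P = X Y\<close>, \<open>Q = Y X = X' Y'\<close> and \<open>R = Y' X'\<close>, the products \<open>X X'\<close> and \<open>Y' Y\<close>
  witness \<open>P \<sim> R\<close>: e.g.\ \<open>X X' Y' Y = X Y X Y = P P\<close>.\<close>

lemma mvn_equiv_trans:
  assumes PQ: "mvn_equiv P Q" and QR: "mvn_equiv Q R" and "idem_mat P" "idem_mat R"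
  shows "mvn_equiv P (R :: 'a::ring_1 mat)"
proof -
  obtain X Y where X: "X \<in> carrier_mat (dim_row P) (dim_row Q)" and Y: "Y \<in> carrier_mat (dim_row Q) (dim_row P)"
    and XY: "X * Y = P" and YX: "Y * X = Q" using PQ unfolding mvn_equiv_def by auto
  obtain X' Y' where X': "X' \<in> carrier_mat (dim_row Q) (dim_row R)" and Y': "Y' \<in> carrier_mat (dim_row R) (dim_row Q)"
    and XY': "X' * Y' = Q" and YX': "Y' * X' = R" using QR unfolding mvn_equiv_def by auto
  have "(X * X') * (Y' * Y) = X * ((X' * Y') * Y)"
    using assoc_mult_mat[OF X X' mult_carrier_mat[OF Y' Y]] assoc_mult_mat[OF X' Y' Y] by simp
  also have "\<dots> = (X * Y) * (X * Y)"
    using assoc_mult_mat[OF Y X Y] assoc_mult_mat[OF X Y mult_carrier_mat[OF X Y]] by (simp add: XY' YX)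
  finally have XY_R: "(X * X') * (Y' * Y) = P" using \<open>idem_mat P\<close> XY by (simp add: idem_mat_def)
  have "(Y' * Y) * (X * X') = Y' * ((Y * X) * X')"
    using assoc_mult_mat[OF Y' Y mult_carrier_mat[OF X X']] assoc_mult_mat[OF Y X X'] by simp
  also have "\<dots> = (Y' * X') * (Y' * X')"
    using assoc_mult_mat[OF X' Y' X'] assoc_mult_mat[OF Y' X' mult_carrier_mat[OF Y' X']] by (simp add: XY'[symmetric] YX)
  finally have YX_R: "(Y' * Y) * (X * X') = R" using \<open>idem_mat R\<close> YX' by (simp add: idem_mat_def)
  show ?thesis
    by (rule mvn_equivI[of "X * X'" _ _ "Y' * Y"]) (use X X' Y Y' XY_R YX_R in auto)
qed

lemma mvn_equiv_dsum:
  assumes "mvn_equiv P P'" "mvn_equiv Q Q'"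
  shows "mvn_equiv (dsum P Q) (dsum P' Q')"
proof -
  obtain X Y where X: "X \<in> carrier_mat (dim_row P) (dim_row P')" and Y: "Y \<in> carrier_mat (dim_row P') (dim_row P)"
    and "X * Y = P" "Y * X = P'" using assms(1) unfolding mvn_equiv_def by auto
  moreover obtain X' Y' where X': "X' \<in> carrier_mat (dim_row Q) (dim_row Q')" and Y': "Y' \<in> carrier_mat (dim_row Q') (dim_row Q)"
    and "X' * Y' = Q" "Y' * X' = Q'" using assms(2) unfolding mvn_equiv_def by auto
  ultimately show ?thesis
    using dsum_carrier_mat[OF X X'] dsum_carrier_mat[OF Y Y'] dsum_mult[OF X Y X' Y'] dsum_mult[OF Y X Y' X']
    by (intro mvn_equivI[of "dsum X X'" _ _ "dsum Y Y'"]) simp_all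
qed

lemma mvn_equiv_dsum_commute:
  assumes "idem_mat P" "idem_mat (Q :: 'a::ring_1 mat)"
  shows "mvn_equiv (dsum P Q) (dsum Q P)"
proof -
  define p q where "p = dim_row P" and "q = dim_row Q"
  note P = idem_matD[OF assms(1), folded p_def] and Q = idem_matD[OF assms(2), folded q_def]
  define X where "X = four_block_mat (0\<^sub>m p q) P Q (0\<^sub>m q p)"
  define Y where "Y = four_block_mat (0\<^sub>m q p) Q P (0\<^sub>m p q)"
  have "X * Y = dsum P Q"
    unfolding X_def Y_def
    by (subst mult_four_block_mat[OF zero_carrier_mat P(1) Q(1) zero_carrier_mat zero_carrier_mat Q(1) P(1)
          zero_carrier_mat]) (use P Q in \<open>simp add: dsum_def\<close>)
  moreover have "Y * X = dsum Q P"
    unfolding X_def Y_def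
    by (subst mult_four_block_mat[OF zero_carrier_mat Q(1) P(1) zero_carrier_mat zero_carrier_mat P(1) Q(1)
          zero_carrier_mat]) (use P Q in \<open>simp add: dsum_def\<close>)
  moreover have "X \<in> carrier_mat (dim_row (dsum P Q)) (dim_row (dsum Q P))"
    "Y \<in> carrier_mat (dim_row (dsum Q P)) (dim_row (dsum P Q))"
    using P Q by (simp_all add: X_def Y_def)
  ultimately show ?thesis
    by (intro mvn_equivI)
qed

lemma zero_mult_zero_mat: "(0\<^sub>m a b :: 'a::semiring_0 mat) * 0\<^sub>m b c = 0\<^sub>m a c"
  by (rule eq_matI) (auto simp: scalar_prod_def)

lemma four_block_mat_empty:
  assumes "A \<in> carrier_mat n m" "B \<in> carrier_mat n 0" "C \<in> carrier_mat 0 m" "D \<in> carrier_mat 0 0"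
  shows "four_block_mat A B C D = A"
  using assms by (intro eq_matI) auto

lemma mvn_equiv_add_orthogonal:
  fixes e1 e2 :: "'a::ring_1 mat"
  assumes c1: "e1 \<in> carrier_mat n n" and c2: "e2 \<in> carrier_mat n n"
    and i1: "e1 * e1 = e1" and i2: "e2 * e2 = e2" and o1: "e1 * e2 = 0\<^sub>m n n" and o2: "e2 * e1 = 0\<^sub>m n n"
  shows "mvn_equiv (e1 + e2) (dsum e1 e2)"
proof -
  define X where "X = four_block_mat e1 e2 (0\<^sub>m 0 n) (0\<^sub>m 0 n :: 'a mat)"
  define Y where "Y = four_block_mat e1 (0\<^sub>m n 0) e2 (0\<^sub>m n 0 :: 'a mat)"
  have "X * Y = four_block_mat (e1 * e1 + e2 * e2) (e1 * 0\<^sub>m n 0 + e2 * 0\<^sub>m n 0)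
     (0\<^sub>m 0 n * e1 + 0\<^sub>m 0 n * e2) (0\<^sub>m 0 n * 0\<^sub>m n 0 + 0\<^sub>m 0 n * 0\<^sub>m n 0)"
    unfolding X_def Y_def
    by (rule mult_four_block_mat[OF c1 c2 zero_carrier_mat zero_carrier_mat c1 zero_carrier_mat c2 zero_carrier_mat])
  also have "\<dots> = four_block_mat (e1 + e2) (0\<^sub>m n 0) (0\<^sub>m 0 n) (0\<^sub>m 0 0)"
    using c1 c2 i1 i2 by (simp add: zero_mult_zero_mat)
  also have "\<dots> = e1 + e2"
    using c1 c2 by (intro four_block_mat_empty) auto
  finally have XY: "X * Y = e1 + e2" .
  have "Y * X = four_block_mat (e1 * e1 + 0\<^sub>m n 0 * 0\<^sub>m 0 n) (e1 * e2 + 0\<^sub>m n 0 * 0\<^sub>m 0 n)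
     (e2 * e1 + 0\<^sub>m n 0 * 0\<^sub>m 0 n) (e2 * e2 + 0\<^sub>m n 0 * 0\<^sub>m 0 n)"
    unfolding X_def Y_def
    by (rule mult_four_block_mat[OF c1 zero_carrier_mat c2 zero_carrier_mat c1 c2 zero_carrier_mat zero_carrier_mat])
  also have "\<dots> = dsum e1 e2"
    using c1 c2 i1 i2 o1 o2 by (simp add: dsum_def zero_mult_zero_mat)
  finally have YX: "Y * X = dsum e1 e2" .
  have "X \<in> carrier_mat (n + 0) (n + n)" "Y \<in> carrier_mat (n + n) (n + 0)"
    unfolding X_def Y_def by (rule four_block_carrier_mat[OF c1 zero_carrier_mat])+
  with XY YX show ?thesis
    using c1 c2 by (intro mvn_equivI) simp_all
qed

section \<open>The monoid \<open>V(R)\<close> of equivalence classes of idempotent matrices\<close>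

definition idem_equiv :: "'a::ring_1 mat \<Rightarrow> 'a mat \<Rightarrow> bool" where
  "idem_equiv P Q \<longleftrightarrow> idem_mat P \<and> idem_mat Q \<and> mvn_equiv P Q"

lemma part_equivp_idem_equiv: "part_equivp idem_equiv"
proof (rule part_equivpI)
  show "\<exists>P. idem_equiv P P"
    using idem_mat_zero mvn_equiv_refl unfolding idem_equiv_def by blast
  show "symp idem_equiv"
    by (auto simp: symp_def idem_equiv_def mvn_equiv_sym)
  show "transp idem_equiv"
    by (auto simp: transp_def idem_equiv_def intro: mvn_equiv_trans)
qed

quotient_type (overloaded) 'a idem_class = "'a::ring_1 mat" / partial: idem_equiv
  by (rule part_equivp_idem_equiv)

instantiation idem_class :: (ring_1) comm_monoid_add
begin

lift_definition zero_idem_class :: "'a idem_class" is "0\<^sub>m 0 0"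
  by (simp add: idem_equiv_def idem_mat_zero mvn_equiv_refl)

lift_definition plus_idem_class :: "'a idem_class \<Rightarrow> 'a idem_class \<Rightarrow> 'a idem_class" is dsum
  by (simp add: idem_equiv_def idem_mat_dsum mvn_equiv_dsum)

instance
proof
  fix a b c :: "'a idem_class"
  show "a + b + c = a + (b + c)"
    by transfer (simp add: idem_equiv_def dsum_assoc idem_mat_dsum mvn_equiv_refl)
  show "a + b = b + a"
    by transfer (simp add: idem_equiv_def idem_mat_dsum mvn_equiv_dsum_commute)
  show "0 + a = a"
    by transfer (simp add: idem_equiv_def dsum_zero_left mvn_equiv_refl)
qed

end

lemma abs_idem_class_eq_iff:
  "idem_mat P \<Longrightarrow> idem_mat Q \<Longrightarrow> abs_idem_class P = abs_idem_class Q \<longleftrightarrow> mvn_equiv P Q"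
  by (metis (mono_tags) Quotient3_rel[OF Quotient3_idem_class] idem_equiv_def mvn_equiv_refl)

lemma idem_mat_rep_idem_class: "idem_mat (rep_idem_class s)"
  using Quotient3_rep_reflp[OF Quotient3_idem_class, of s] by (simp add: idem_equiv_def)

lemma abs_rep_idem_class: "abs_idem_class (rep_idem_class s) = s"
  by (rule Quotient3_abs_rep[OF Quotient3_idem_class])

lemma idem_class_cases:
  obtains P where "idem_mat P" "s = abs_idem_class P"
  using idem_mat_rep_idem_class abs_rep_idem_class by metis

lemma abs_idem_class_dsum:
  assumes "idem_mat P" "idem_mat Q"
  shows "abs_idem_class (dsum P Q) = abs_idem_class P + abs_idem_class Q"
proof -
  have "idem_equiv P P" "idem_equiv Q Q"
    using assms by (auto simp: idem_equiv_def mvn_equiv_refl)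
  then have "idem_equiv (rep_idem_class (abs_idem_class P)) P" "idem_equiv (rep_idem_class (abs_idem_class Q)) Q"
    by (auto intro: Quotient3_rep_abs[OF Quotient3_idem_class])
  then have "idem_equiv (dsum (rep_idem_class (abs_idem_class P)) (rep_idem_class (abs_idem_class Q))) (dsum P Q)"
    by (simp add: idem_equiv_def idem_mat_dsum mvn_equiv_dsum)
  then show ?thesis
    unfolding plus_idem_class_def by (simp add: Quotient3_rel_abs[OF Quotient3_idem_class])
qed

lemma abs_idem_class_zero: "abs_idem_class (0\<^sub>m 0 0) = 0"
  by (simp add: zero_idem_class_def)

lemma abs_idem_class_zero_mat: "abs_idem_class (0\<^sub>m n n :: 'a::ring_1 mat) = 0"
proof -
  have "mvn_equiv (0\<^sub>m n n :: 'a mat) (0\<^sub>m 0 0)"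
    by (rule mvn_equivI[of "0\<^sub>m n 0" _ _ "0\<^sub>m 0 n"]) (simp_all add: zero_mult_zero_mat)
  moreover have "idem_mat (0\<^sub>m n n :: 'a mat)"
    by (simp add: idem_mat_def zero_mult_zero_mat)
  ultimately show ?thesis
    by (simp add: abs_idem_class_eq_iff idem_mat_zero abs_idem_class_zero[symmetric])
qed

lemma one_mat_Suc_dsum: "1\<^sub>m (Suc n) = dsum (1\<^sub>m n) (1\<^sub>m 1 :: 'a::ring_1 mat)"
proof (rule eq_matI)
  fix r c assume "r < dim_row (dsum (1\<^sub>m n) (1\<^sub>m 1 :: 'a mat))" "c < dim_col (dsum (1\<^sub>m n) (1\<^sub>m 1 :: 'a mat))"
  then show "1\<^sub>m (Suc n) $$ (r, c) = dsum (1\<^sub>m n) (1\<^sub>m 1 :: 'a mat) $$ (r, c)"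
    by (cases "r < n"; cases "c < n") (simp_all add: index_dsum_blocks)
qed auto

lemma abs_idem_class_one_mat: "abs_idem_class (1\<^sub>m n :: 'a::ring_1 mat) = (\<Sum>_<n. abs_idem_class (1\<^sub>m 1))"
proof (induction n)
  case 0
  have "1\<^sub>m 0 = (0\<^sub>m 0 0 :: 'a mat)"
    by (rule eq_matI) auto
  then show ?case by (simp add: abs_idem_class_zero)
next
  case (Suc n)
  have "abs_idem_class (1\<^sub>m (Suc n) :: 'a mat) = abs_idem_class (1\<^sub>m n :: 'a mat) + abs_idem_class (1\<^sub>m 1)"
    by (simp only: one_mat_Suc_dsum abs_idem_class_dsum[OF idem_mat_one idem_mat_one])
  with Suc.IH show ?case
    by simp
qed

lemma abs_idem_class_add_orthogonal:
  fixes e1 e2 :: "'a::ring_1 mat"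
  assumes "e1 \<in> carrier_mat n n" "e2 \<in> carrier_mat n n"
    and "e1 * e1 = e1" "e2 * e2 = e2" "e1 * e2 = 0\<^sub>m n n" "e2 * e1 = 0\<^sub>m n n"
  shows "abs_idem_class (e1 + e2) = abs_idem_class e1 + abs_idem_class e2"
proof -
  have "(e1 + e2) * (e1 + e2) = e1 * e1 + e2 * e1 + (e1 * e2 + e2 * e2)"
    using assms(1,2) by (simp add: add_mult_distrib_mat[of _ n n] mult_add_distrib_mat[of _ n n])
  then have "idem_mat (e1 + e2)"
    using assms by (simp add: idem_mat_def)
  moreover have "idem_mat e1" "idem_mat e2"
    using assms by (auto simp: idem_mat_def)
  ultimately show ?thesis
    using mvn_equiv_add_orthogonal[OF assms]
    by (simp add: abs_idem_class_eq_iff idem_mat_dsum abs_idem_class_dsum[symmetric])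
qed

section \<open>\<open>K\<^sub>0(R)\<close> as the Grothendieck group of \<open>V(R)\<close>\<close>

definition grothendieck_eq :: "'b::comm_monoid_add \<times> 'b \<Rightarrow> 'b \<times> 'b \<Rightarrow> bool" where
  "grothendieck_eq x y \<longleftrightarrow> (\<exists>s. fst x + snd y + s = fst y + snd x + s)"

lemma grothendieck_eq_refl: "grothendieck_eq x x"
  by (auto simp: grothendieck_eq_def)

lemma grothendieck_eq_sym: "grothendieck_eq x y \<Longrightarrow> grothendieck_eq y x"
  unfolding grothendieck_eq_def by metis

lemma grothendieck_eq_trans:
  assumes "grothendieck_eq x y" "grothendieck_eq y z"
  shows "grothendieck_eq x z"
proof -
  obtain s t where s: "fst x + snd y + s = fst y + snd x + s" and t: "fst y + snd z + t = fst z + snd y + t"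
    using assms by (auto simp: grothendieck_eq_def)
  have "fst x + snd z + (fst y + snd y + s + t) = (fst x + snd y + s) + (fst y + snd z + t)"
    by (simp add: ac_simps)
  also have "\<dots> = fst z + snd x + (fst y + snd y + s + t)"
    unfolding s t by (simp add: ac_simps)
  finally show ?thesis
    unfolding grothendieck_eq_def by blast
qed

lemma grothendieck_eq_add:
  assumes "grothendieck_eq x x'" "grothendieck_eq y y'"
  shows "grothendieck_eq (x + y) (x' + y')"
proof -
  obtain s t where s: "fst x + snd x' + s = fst x' + snd x + s" and t: "fst y + snd y' + t = fst y' + snd y + t"
    using assms by (auto simp: grothendieck_eq_def)
  have "fst (x + y) + snd (x' + y') + (s + t) = (fst x + snd x' + s) + (fst y + snd y' + t)"
    by (simp add: ac_simps)
  also have "\<dots> = fst (x' + y') + snd (x + y) + (s + t)"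
    unfolding s t by (simp add: ac_simps)
  finally show ?thesis
    unfolding grothendieck_eq_def by blast
qed

lemma grothendieck_eq_map:
  assumes add: "\<And>a b. f (a + b) = f a + f b" and "grothendieck_eq x y"
  shows "grothendieck_eq (f (fst x), f (snd x)) (f (fst y), f (snd y))"
proof -
  obtain s where "fst x + snd y + s = fst y + snd x + s"
    using assms(2) by (auto simp: grothendieck_eq_def)
  then have "f (fst x) + f (snd y) + f s = f (fst y) + f (snd x) + f s"
    by (metis add)
  then show ?thesis
    unfolding grothendieck_eq_def by auto
qed

definition pair_classes :: "'a::ring_1 mat \<times> 'a mat \<Rightarrow> 'a idem_class \<times> 'a idem_class" where
  "pair_classes p = (abs_idem_class (fst p), abs_idem_class (snd p))"

definition dsum_pair :: "'a::ring_1 mat \<times> 'a mat \<Rightarrow> 'a mat \<times> 'a mat \<Rightarrow> 'a mat \<times> 'a mat" where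
  "dsum_pair p q = (dsum (fst p) (fst q), dsum (snd p) (snd q))"

abbreviation K0_cls :: "'a::ring_1 mat \<times> 'a mat \<Rightarrow> ('a mat \<times> 'a mat) set" where
  "K0_cls \<equiv> K0_class TYPE('a)"

lemma K0_pairs_iff: "p \<in> K0_pairs TYPE('a::ring_1) \<longleftrightarrow> idem_mat (fst p) \<and> idem_mat (snd p)"
  by (cases p) (simp add: K0_pairs_def)

lemma zero_in_K0_pairs: "(0\<^sub>m 0 0, 0\<^sub>m 0 0) \<in> K0_pairs TYPE('a::ring_1)"
  by (simp add: K0_pairs_iff idem_mat_zero)

lemma unit_in_K0_pairs: "(1\<^sub>m 1, 0\<^sub>m 0 0) \<in> K0_pairs TYPE('a::ring_1)"
  by (simp add: K0_pairs_iff idem_mat_one idem_mat_zero)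

lemma dsum_pair_in_K0_pairs:
  "p \<in> K0_pairs TYPE('a::ring_1) \<Longrightarrow> q \<in> K0_pairs TYPE('a) \<Longrightarrow> dsum_pair p q \<in> K0_pairs TYPE('a)"
  by (simp add: K0_pairs_iff dsum_pair_def idem_mat_dsum)

lemma pair_classes_dsum_pair:
  "p \<in> K0_pairs TYPE('a::ring_1) \<Longrightarrow> q \<in> K0_pairs TYPE('a) \<Longrightarrow>
    pair_classes (dsum_pair p q) = pair_classes p + pair_classes q"
  by (simp add: K0_pairs_iff dsum_pair_def pair_classes_def abs_idem_class_dsum)

lemma K0_rel_iff:
  "(p, q) \<in> K0_rel TYPE('a::ring_1) \<longleftrightarrow>
    p \<in> K0_pairs TYPE('a) \<and> q \<in> K0_pairs TYPE('a) \<and> grothendieck_eq (pair_classes p) (pair_classes q)"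
proof (cases "p \<in> K0_pairs TYPE('a) \<and> q \<in> K0_pairs TYPE('a)")
  case True
  obtain P Q P' Q' where pq: "p = (P, Q)" "q = (P', Q')"
    by (cases p, cases q)
  with True have idem: "idem_mat P" "idem_mat Q" "idem_mat P'" "idem_mat Q'"
    by (auto simp: K0_pairs_iff)
  have stable: "mvn_equiv (dsum (dsum P Q') S) (dsum (dsum P' Q) S) \<longleftrightarrow>
      abs_idem_class P + abs_idem_class Q' + abs_idem_class S = abs_idem_class P' + abs_idem_class Q + abs_idem_class S"
    if "idem_mat S" for S
    using idem that by (simp add: abs_idem_class_eq_iff[symmetric] idem_mat_dsum abs_idem_class_dsum)
  have "(\<exists>S. idem_mat S \<and> mvn_equiv (dsum (dsum P Q') S) (dsum (dsum P' Q) S)) \<longleftrightarrow>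
      (\<exists>s. abs_idem_class P + abs_idem_class Q' + s = abs_idem_class P' + abs_idem_class Q + s)"
    by (metis stable idem_class_cases)
  then show ?thesis
    using True pq by (simp add: K0_rel_def grothendieck_eq_def pair_classes_def)
qed (auto simp: K0_rel_def)

lemma equiv_K0_rel: "equiv (K0_pairs TYPE('a::ring_1)) (K0_rel TYPE('a))"
proof (rule equivI)
  show "refl_on (K0_pairs TYPE('a)) (K0_rel TYPE('a))"
    by (rule refl_onI) (auto simp: K0_rel_iff grothendieck_eq_refl)
  show "sym (K0_rel TYPE('a))"
    by (rule symI) (simp add: K0_rel_iff grothendieck_eq_sym)
  show "trans (K0_rel TYPE('a))"
    by (rule transI) (auto simp: K0_rel_iff intro: grothendieck_eq_trans)
  show "K0_rel TYPE('a) \<subseteq> K0_pairs TYPE('a) \<times> K0_pairs TYPE('a)"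
    by (clarsimp simp: K0_rel_iff)
qed

lemma K0_cls_in_carrier: "p \<in> K0_pairs TYPE('a::ring_1) \<Longrightarrow> K0_cls p \<in> carrier (K0 TYPE('a))"
  unfolding K0_def K0_class_def by (auto intro: quotientI)

lemma K0_carrier_cases:
  assumes "A \<in> carrier (K0 TYPE('a::ring_1))"
  obtains p where "p \<in> K0_pairs TYPE('a)" "A = K0_cls p"
  using assms unfolding K0_def K0_class_def by (auto elim: quotientE)

lemma K0_cls_eq_iff:
  "p \<in> K0_pairs TYPE('a::ring_1) \<Longrightarrow> q \<in> K0_pairs TYPE('a) \<Longrightarrow>
    K0_cls p = K0_cls q \<longleftrightarrow> grothendieck_eq (pair_classes p) (pair_classes q)"
  unfolding K0_class_def using equiv_class_eq_iff[OF equiv_K0_rel, of p q] K0_rel_iff[of p q] by blast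

lemma some_in_K0_cls:
  assumes "p \<in> K0_pairs TYPE('a::ring_1)"
  defines "a \<equiv> SOME a. a \<in> K0_cls p"
  shows "a \<in> K0_pairs TYPE('a)" "K0_cls a = K0_cls p"
proof -
  have "p \<in> K0_cls p"
    using assms(1) by (simp add: K0_class_def K0_rel_iff grothendieck_eq_refl)
  then have "a \<in> K0_cls p"
    unfolding a_def by (rule someI)
  then have pa: "(p, a) \<in> K0_rel TYPE('a)"
    by (simp add: K0_class_def)
  then show "a \<in> K0_pairs TYPE('a)"
    by (simp add: K0_rel_iff)
  show "K0_cls a = K0_cls p"
    unfolding K0_class_def using equiv_class_eq[OF equiv_K0_rel pa] by simp
qed

lemma K0_cls_mult:
  assumes p: "p \<in> K0_pairs TYPE('a::ring_1)" and q: "q \<in> K0_pairs TYPE('a)"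
  shows "K0_cls p \<otimes>\<^bsub>K0 TYPE('a)\<^esub> K0_cls q = K0_cls (dsum_pair p q)"
proof -
  define a b where "a = (SOME a. a \<in> K0_cls p)" and "b = (SOME b. b \<in> K0_cls q)"
  note a = some_in_K0_cls[OF p, folded a_def] and b = some_in_K0_cls[OF q, folded b_def]
  have "K0_cls p \<otimes>\<^bsub>K0 TYPE('a)\<^esub> K0_cls q = K0_cls (dsum_pair a b)"
    unfolding K0_def by (simp add: a_def b_def dsum_pair_def Let_def)
  also have "\<dots> = K0_cls (dsum_pair p q)"
    using a b p q
    by (simp add: K0_cls_eq_iff dsum_pair_in_K0_pairs pair_classes_dsum_pair grothendieck_eq_add)
  finally show ?thesis .
qed

lemma K0_unit_in_carrier: "K0_unit TYPE('a::ring_1) \<in> carrier (K0 TYPE('a))"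
  unfolding K0_unit_def by (rule K0_cls_in_carrier[OF unit_in_K0_pairs])

lemma K0_one: "\<one>\<^bsub>K0 TYPE('a::ring_1)\<^esub> = K0_cls (0\<^sub>m 0 0, 0\<^sub>m 0 0)"
  by (simp add: K0_def)

lemma comm_group_K0: "comm_group (K0 TYPE('a::ring_1))"
proof (rule comm_groupI)
  fix x y z
  assume "x \<in> carrier (K0 TYPE('a))" "y \<in> carrier (K0 TYPE('a))" "z \<in> carrier (K0 TYPE('a))"
  then obtain p q r where p: "p \<in> K0_pairs TYPE('a)" "x = K0_cls p" and q: "q \<in> K0_pairs TYPE('a)" "y = K0_cls q"
    and r: "r \<in> K0_pairs TYPE('a)" "z = K0_cls r"
    by (metis K0_carrier_cases)
  show "x \<otimes>\<^bsub>K0 TYPE('a)\<^esub> y \<in> carrier (K0 TYPE('a))"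
    using p q by (simp add: K0_cls_mult K0_cls_in_carrier dsum_pair_in_K0_pairs)
  show "x \<otimes>\<^bsub>K0 TYPE('a)\<^esub> y \<otimes>\<^bsub>K0 TYPE('a)\<^esub> z = x \<otimes>\<^bsub>K0 TYPE('a)\<^esub> (y \<otimes>\<^bsub>K0 TYPE('a)\<^esub> z)"
    using p q r
    by (simp add: K0_cls_mult dsum_pair_in_K0_pairs K0_cls_eq_iff pair_classes_dsum_pair add.assoc
        grothendieck_eq_refl)
  show "x \<otimes>\<^bsub>K0 TYPE('a)\<^esub> y = y \<otimes>\<^bsub>K0 TYPE('a)\<^esub> x"
    using p q
    by (simp add: K0_cls_mult dsum_pair_in_K0_pairs K0_cls_eq_iff pair_classes_dsum_pair add.commute
        grothendieck_eq_refl)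
  show "\<one>\<^bsub>K0 TYPE('a)\<^esub> \<otimes>\<^bsub>K0 TYPE('a)\<^esub> x = x"
    using p zero_in_K0_pairs[where 'a='a] by (simp add: K0_one K0_cls_mult dsum_pair_def dsum_zero_left)
  have swap: "(snd p, fst p) \<in> K0_pairs TYPE('a)"
    using p by (simp add: K0_pairs_iff)
  have "grothendieck_eq (pair_classes (dsum_pair (snd p, fst p) p)) (pair_classes (0\<^sub>m 0 0, 0\<^sub>m 0 0))"
    using swap p by (simp add: pair_classes_dsum_pair) (simp add: pair_classes_def grothendieck_eq_def
        abs_idem_class_zero add.commute)
  then show "\<exists>y\<in>carrier (K0 TYPE('a)). y \<otimes>\<^bsub>K0 TYPE('a)\<^esub> x = \<one>\<^bsub>K0 TYPE('a)\<^esub>"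
    using p swap zero_in_K0_pairs[where 'a='a] dsum_pair_in_K0_pairs[OF swap p(1)]
    by (intro bexI[of _ "K0_cls (snd p, fst p)"]) (simp_all add: K0_one K0_cls_mult K0_cls_eq_iff K0_cls_in_carrier)
next
  show "\<one>\<^bsub>K0 TYPE('a)\<^esub> \<in> carrier (K0 TYPE('a))"
    by (simp add: K0_one K0_cls_in_carrier zero_in_K0_pairs)
qed

lemma K0_cls_nat_pow:
  assumes p: "p \<in> K0_pairs TYPE('a::ring_1)"
  obtains q where "q \<in> K0_pairs TYPE('a)" "K0_cls p [^]\<^bsub>K0 TYPE('a)\<^esub> (n::nat) = K0_cls q"
    "pair_classes q = (\<Sum>_<n. pair_classes p)"
proof (induction n arbitrary: thesis)
  case 0
  show ?case
    by (rule 0[OF zero_in_K0_pairs]) (simp_all add: K0_one pair_classes_def abs_idem_class_zero zero_prod_def)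
next
  case (Suc n)
  obtain q where q: "q \<in> K0_pairs TYPE('a)" "K0_cls p [^]\<^bsub>K0 TYPE('a)\<^esub> n = K0_cls q"
    "pair_classes q = (\<Sum>_<n. pair_classes p)"
    using Suc.IH by blast
  show ?case
    by (rule Suc.prems[OF dsum_pair_in_K0_pairs[OF q(1) p]])
      (use q p in \<open>simp_all add: K0_cls_mult pair_classes_dsum_pair add.commute\<close>)
qed

section \<open>Maps on \<open>K\<^sub>0(R)\<close> induced by non-unital homomorphisms \<open>R \<rightarrow> M\<^sub>m(R)\<close>\<close>

lemma sum_lessThan_mult_split:
  "(\<Sum>u<b * m. g u) = (\<Sum>k<b. \<Sum>w<m. g (k * m + w))" for g :: "nat \<Rightarrow> 'b::comm_monoid_add"
proof -
  have "(\<Sum>u<b * m. g u) = (\<Sum>k<b. sum g {k * m..<k * m + m})"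
    by (rule sum.nat_group[symmetric])
  also have "\<dots> = (\<Sum>k<b. \<Sum>w<m. g (k * m + w))"
    using sum.shift_bounds_nat_ivl[of g 0 "k * m" m for k]
    by (simp add: atLeast0LessThan add.commute)
  finally show ?thesis .
qed

locale nonunital_mat_hom =
  fixes h :: "'a::ring_1 \<Rightarrow> 'a mat" and m :: nat
  assumes m_pos: "0 < m"
    and carrier: "h a \<in> carrier_mat m m"
    and add: "h (a + b) = h a + h b"
    and mult: "h (a * b) = h a * h b"
begin

definition amplify :: "'a mat \<Rightarrow> 'a mat" where
  "amplify M = mat (dim_row M * m) (dim_col M * m) (\<lambda>(r, c). h (M $$ (r div m, c div m)) $$ (r mod m, c mod m))"

lemma index_zero: "s < m \<Longrightarrow> t < m \<Longrightarrow> h 0 $$ (s, t) = 0"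
  using add[of 0 0] carrier[of 0] by (metis add_0 add_cancel_right_right index_add_mat(1) carrier_matD)

lemma index_sum: "finite K \<Longrightarrow> s < m \<Longrightarrow> t < m \<Longrightarrow> h (\<Sum>k\<in>K. f k) $$ (s, t) = (\<Sum>k\<in>K. h (f k) $$ (s, t))"
proof (induction K rule: finite_induct)
  case empty
  then show ?case by (simp add: index_zero)
next
  case (insert k K)
  then show ?case
    using carrier[of "f k"] carrier[of "sum f K"] by (simp add: add)
qed

lemma index_mult: "s < m \<Longrightarrow> t < m \<Longrightarrow> h (a * b) $$ (s, t) = (\<Sum>w<m. h a $$ (s, w) * h b $$ (w, t))"
  using carrier[of a] carrier[of b] by (simp add: mult scalar_prod_def atLeast0LessThan)

lemma dim_amplify [simp]:
  "dim_row (amplify M) = dim_row M * m" "dim_col (amplify M) = dim_col M * m"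
  by (simp_all add: amplify_def)

lemma amplify_carrier_mat: "M \<in> carrier_mat a b \<Longrightarrow> amplify M \<in> carrier_mat (a * m) (b * m)"
  by (intro carrier_matI) (simp_all only: dim_amplify carrier_matD)

lemma index_amplify:
  "r < dim_row M * m \<Longrightarrow> c < dim_col M * m \<Longrightarrow>
    amplify M $$ (r, c) = h (M $$ (r div m, c div m)) $$ (r mod m, c mod m)"
  by (simp add: amplify_def)

lemma less_mult_iff_div_less: "r < p * m \<longleftrightarrow> r div m < p"
  using m_pos by (simp add: div_less_iff_less_mult)

lemma amplify_mult:
  assumes M: "M \<in> carrier_mat a b" and N: "N \<in> carrier_mat b c"
  shows "amplify (M * N) = amplify M * amplify N"
proof (rule eq_matI)
  fix r s assume "r < dim_row (amplify M * amplify N)" "s < dim_col (amplify M * amplify N)"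
  then have r: "r < a * m" and s: "s < c * m"
    using M N by auto
  have rm: "r mod m < m" and sm: "s mod m < m"
    using m_pos by auto
  have "amplify (M * N) $$ (r, s) =
      h (\<Sum>k<b. M $$ (r div m, k) * N $$ (k, s div m)) $$ (r mod m, s mod m)"
    using r s M N less_mult_iff_div_less by (simp add: index_amplify scalar_prod_def atLeast0LessThan)
  also have "\<dots> = (\<Sum>k<b. \<Sum>w<m. h (M $$ (r div m, k)) $$ (r mod m, w) * h (N $$ (k, s div m)) $$ (w, s mod m))"
    using rm sm by (simp add: index_sum index_mult)
  also have "\<dots> = (\<Sum>k<b. \<Sum>w<m. amplify M $$ (r, k * m + w) * amplify N $$ (k * m + w, s))"
  proof (intro sum.cong refl)
    fix k w assume k: "k \<in> {..<b}" and w: "w \<in> {..<m}"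
    have "Suc k * m \<le> b * m"
      using k by (intro mult_le_mono1) simp
    then have "k * m + w < b * m"
      using w by simp
    then show "h (M $$ (r div m, k)) $$ (r mod m, w) * h (N $$ (k, s div m)) $$ (w, s mod m) =
        amplify M $$ (r, k * m + w) * amplify N $$ (k * m + w, s)"
      using r s w M N by (simp add: index_amplify)
  qed
  also have "\<dots> = (\<Sum>u<b * m. amplify M $$ (r, u) * amplify N $$ (u, s))"
    by (rule sum_lessThan_mult_split[symmetric])
  also have "\<dots> = (amplify M * amplify N) $$ (r, s)"
    using r s M N by (simp add: scalar_prod_def atLeast0LessThan)
  finally show "amplify (M * N) $$ (r, s) = (amplify M * amplify N) $$ (r, s)" .
qed (use M N in auto)

lemma div_mod_diff_mult:
  assumes "p * m \<le> r"
  shows "(r - p * m) div m = r div m - p" "(r - p * m) mod m = r mod m"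
proof -
  obtain r' where "r = p * m + r'"
    using assms le_Suc_ex by blast
  then show "(r - p * m) div m = r div m - p" "(r - p * m) mod m = r mod m"
    using m_pos by simp_all
qed

lemma amplify_dsum: "amplify (dsum P Q) = dsum (amplify P) (amplify Q)"
proof (rule eq_matI)
  fix r c assume "r < dim_row (dsum (amplify P) (amplify Q))" "c < dim_col (dsum (amplify P) (amplify Q))"
  then have r: "r < (dim_row P + dim_row Q) * m" and c: "c < (dim_col P + dim_col Q) * m"
    by (simp_all add: distrib_right)
  then have rd: "r div m < dim_row P + dim_row Q" and cd: "c div m < dim_col P + dim_col Q"
    by (simp_all only: less_mult_iff_div_less)
  have rm: "r mod m < m" and cm: "c mod m < m"
    using m_pos by auto
  have lhs: "amplify (dsum P Q) $$ (r, c) = h (dsum P Q $$ (r div m, c div m)) $$ (r mod m, c mod m)"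
    using r c by (simp add: index_amplify)
  show "amplify (dsum P Q) $$ (r, c) = dsum (amplify P) (amplify Q) $$ (r, c)"
  proof (cases "r < dim_row P * m"; cases "c < dim_col P * m")
    assume "r < dim_row P * m" "c < dim_col P * m"
    then show ?thesis
      using lhs by (simp add: less_mult_iff_div_less index_dsum_UL index_amplify)
  next
    assume a: "r < dim_row P * m" "\<not> c < dim_col P * m"
    then show ?thesis
      using lhs r c rd cd rm cm
      by (simp add: less_mult_iff_div_less index_dsum_UR index_zero distrib_right)
  next
    assume "\<not> r < dim_row P * m" "c < dim_col P * m"
    then show ?thesis
      using lhs r c rd cd rm cm
      by (simp add: less_mult_iff_div_less index_dsum_LL index_zero distrib_right)
  next
    assume a: "\<not> r < dim_row P * m" "\<not> c < dim_col P * m"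
    have "dsum (amplify P) (amplify Q) $$ (r, c) = amplify Q $$ (r - dim_row P * m, c - dim_col P * m)"
      using a r c by (simp add: index_dsum_LR distrib_right)
    also have "\<dots> = h (Q $$ (r div m - dim_row P, c div m - dim_col P)) $$ (r mod m, c mod m)"
      using a r c div_mod_diff_mult[of "dim_row P" r] div_mod_diff_mult[of "dim_col P" c]
      by (simp add: index_amplify distrib_right)
    finally show ?thesis
      using lhs a rd cd by (simp add: less_mult_iff_div_less index_dsum_LR)
  qed
qed (simp_all add: distrib_right)

lemma amplify_one_mat: "amplify (1\<^sub>m 1) = h 1"
proof (rule eq_matI)
  fix r c assume "r < dim_row (h 1)" "c < dim_col (h 1)"
  then show "amplify (1\<^sub>m 1) $$ (r, c) = h 1 $$ (r, c)"
    using carrier[of 1] by (simp add: index_amplify)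
qed (use carrier[of 1] in auto)

lemma amplify_zero_mat: "amplify (0\<^sub>m 0 0) = 0\<^sub>m 0 0"
  by (rule eq_matI) auto

lemma idem_mat_amplify:
  assumes "idem_mat P"
  shows "idem_mat (amplify P)"
proof -
  note P = idem_matD[OF assms]
  have "amplify P * amplify P = amplify P"
    using amplify_mult[OF P(1) P(1)] P(2) by simp
  then show ?thesis
    using amplify_carrier_mat[OF P(1)] by (simp add: idem_mat_def)
qed

lemma mvn_equiv_amplify:
  assumes "mvn_equiv P Q"
  shows "mvn_equiv (amplify P) (amplify Q)"
proof -
  obtain X Y where X: "X \<in> carrier_mat (dim_row P) (dim_row Q)" and Y: "Y \<in> carrier_mat (dim_row Q) (dim_row P)"
    and "X * Y = P" "Y * X = Q"
    using assms unfolding mvn_equiv_def by blast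
  then show ?thesis
    using amplify_mult[OF X Y] amplify_mult[OF Y X] amplify_carrier_mat[OF X] amplify_carrier_mat[OF Y]
    by (intro mvn_equivI[of "amplify X" _ _ "amplify Y"]) simp_all
qed

definition idem_class_map :: "'a idem_class \<Rightarrow> 'a idem_class" where
  "idem_class_map s = abs_idem_class (amplify (rep_idem_class s))"

lemma idem_class_map_abs:
  assumes "idem_mat P"
  shows "idem_class_map (abs_idem_class P) = abs_idem_class (amplify P)"
proof -
  have "idem_equiv P P"
    using assms by (simp add: idem_equiv_def mvn_equiv_refl)
  then have "idem_equiv (rep_idem_class (abs_idem_class P)) P"
    by (rule Quotient3_rep_abs[OF Quotient3_idem_class])
  then show ?thesis
    unfolding idem_class_map_def
    by (simp add: idem_equiv_def abs_idem_class_eq_iff idem_mat_amplify mvn_equiv_amplify)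
qed

lemma idem_class_map_add: "idem_class_map (s + t) = idem_class_map s + idem_class_map t"
proof -
  obtain S T where S: "idem_mat S" "s = abs_idem_class S" and T: "idem_mat T" "t = abs_idem_class T"
    by (metis idem_class_cases)
  then show ?thesis
    by (simp add: abs_idem_class_dsum[symmetric] idem_class_map_abs idem_mat_dsum amplify_dsum
        idem_mat_amplify)
qed

definition K0_map :: "('a mat \<times> 'a mat) set \<Rightarrow> ('a mat \<times> 'a mat) set" where
  "K0_map A = K0_cls (map_prod amplify amplify (SOME a. a \<in> A))"

lemma map_prod_amplify_in_K0_pairs:
  "p \<in> K0_pairs TYPE('a) \<Longrightarrow> map_prod amplify amplify p \<in> K0_pairs TYPE('a)"
  by (cases p) (simp add: K0_pairs_iff idem_mat_amplify)

lemma pair_classes_map_prod_amplify: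
  "p \<in> K0_pairs TYPE('a) \<Longrightarrow>
    pair_classes (map_prod amplify amplify p) =
      (idem_class_map (fst (pair_classes p)), idem_class_map (snd (pair_classes p)))"
  by (cases p) (simp add: K0_pairs_iff pair_classes_def idem_class_map_abs)

lemma K0_map_cls:
  assumes p: "p \<in> K0_pairs TYPE('a)"
  shows "K0_map (K0_cls p) = K0_cls (map_prod amplify amplify p)"
proof -
  define a where "a = (SOME a. a \<in> K0_cls p)"
  note a = some_in_K0_cls[OF p, folded a_def]
  have "grothendieck_eq (pair_classes a) (pair_classes p)"
    using a p by (simp add: K0_cls_eq_iff[symmetric])
  then have "grothendieck_eq (pair_classes (map_prod amplify amplify a)) (pair_classes (map_prod amplify amplify p))"
    unfolding pair_classes_map_prod_amplify[OF a(1)] pair_classes_map_prod_amplify[OF p]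
    by (rule grothendieck_eq_map[OF idem_class_map_add])
  then show ?thesis
    unfolding K0_map_def a_def[symmetric]
    using a(1) p by (simp add: K0_cls_eq_iff map_prod_amplify_in_K0_pairs)
qed

lemma K0_map_hom: "K0_map \<in> hom (K0 TYPE('a)) (K0 TYPE('a))"
proof (rule homI)
  fix x assume "x \<in> carrier (K0 TYPE('a))"
  then obtain p where "p \<in> K0_pairs TYPE('a)" "x = K0_cls p"
    by (rule K0_carrier_cases)
  then show "K0_map x \<in> carrier (K0 TYPE('a))"
    by (simp add: K0_map_cls K0_cls_in_carrier map_prod_amplify_in_K0_pairs)
next
  fix x y assume "x \<in> carrier (K0 TYPE('a))" "y \<in> carrier (K0 TYPE('a))"
  then obtain p q where p: "p \<in> K0_pairs TYPE('a)" "x = K0_cls p" and q: "q \<in> K0_pairs TYPE('a)" "y = K0_cls q"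
    by (metis K0_carrier_cases)
  have "map_prod amplify amplify (dsum_pair p q) = dsum_pair (map_prod amplify amplify p) (map_prod amplify amplify q)"
    by (simp add: dsum_pair_def map_prod_def split_beta amplify_dsum)
  then show "K0_map (x \<otimes>\<^bsub>K0 TYPE('a)\<^esub> y) = K0_map x \<otimes>\<^bsub>K0 TYPE('a)\<^esub> K0_map y"
    using p q by (simp add: K0_cls_mult K0_map_cls dsum_pair_in_K0_pairs map_prod_amplify_in_K0_pairs)
qed

lemma K0_map_unit: "K0_map (K0_unit TYPE('a)) = K0_cls (h 1, 0\<^sub>m 0 0)"
proof -
  have "map_prod amplify amplify (1\<^sub>m 1, 0\<^sub>m 0 0) = (h 1, 0\<^sub>m 0 0)"
    by (simp only: map_prod_simp amplify_one_mat amplify_zero_mat)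
  then show ?thesis
    unfolding K0_unit_def using unit_in_K0_pairs[where 'a='a] by (simp only: K0_map_cls)
qed

end

section \<open>The endomorphism of \<open>K\<^sub>0(R)\<close> induced by a ring homomorphism \<open>M\<^sub>i(R) \<rightarrow> M\<^sub>j(R)\<close>\<close>

lemma ring_ring_mat: "ring (ring_mat TYPE('a::ring_1) n b)"
  by unfold_locales (insert add_inv_exists_mat, auto simp: ring_mat_def algebra_simps Units_def)

definition mat_unit :: "nat \<Rightarrow> nat \<Rightarrow> nat \<Rightarrow> 'a::ring_1 mat" where
  "mat_unit n s t = mat n n (\<lambda>(r, c). if r = s \<and> c = t then 1 else 0)"

definition corner :: "nat \<Rightarrow> 'a::ring_1 \<Rightarrow> 'a mat" where
  "corner n a = mat n n (\<lambda>(r, c). if r = 0 \<and> c = 0 then a else 0)"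

lemma mat_unit_carrier_mat [simp]: "mat_unit n s t \<in> carrier_mat n n"
  by (simp add: mat_unit_def)

lemma corner_carrier_mat [simp]: "corner n a \<in> carrier_mat n n"
  by (simp add: corner_def)

lemma mat_unit_mult:
  assumes "t < n"
  shows "mat_unit n s t * mat_unit n t v = (mat_unit n s v :: 'a::ring_1 mat)"
proof (rule eq_matI)
  fix r c assume "r < dim_row (mat_unit n s v :: 'a mat)" "c < dim_col (mat_unit n s v :: 'a mat)"
  then have rc: "r < n" "c < n"
    by (auto simp: mat_unit_def)
  have "(mat_unit n s t * mat_unit n t v :: 'a mat) $$ (r, c) =
      (\<Sum>w\<in>{0..<n}. (if r = s \<and> w = t then 1 else 0) * (if w = t \<and> c = v then 1 else (0::'a)))"
    using rc by (simp add: mat_unit_def scalar_prod_def)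
  also have "\<dots> = (\<Sum>w\<in>{0..<n}. if w = t then (if r = s \<and> c = v then 1 else 0) else 0)"
    by (rule sum.cong) auto
  also have "\<dots> = mat_unit n s v $$ (r, c)"
    using assms rc by (simp add: mat_unit_def)
  finally show "(mat_unit n s t * mat_unit n t v :: 'a mat) $$ (r, c) = mat_unit n s v $$ (r, c)" .
qed (auto simp: mat_unit_def)

lemma mat_unit_diag: "mat_unit n k k = mat_diag n (\<lambda>r. if r = k then 1 else 0)"
  by (rule eq_matI) (auto simp: mat_diag_def mat_unit_def)

lemma corner_add: "corner n (a + b) = corner n a + corner n b"
  by (rule eq_matI) (auto simp: corner_def)

lemma corner_mult:
  assumes "0 < n"
  shows "corner n a * corner n b = corner n (a * b)"
proof (rule eq_matI)
  fix r c assume "r < dim_row (corner n (a * b))" "c < dim_col (corner n (a * b))"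
  then have rc: "r < n" "c < n"
    by (auto simp: corner_def)
  have "(corner n a * corner n b) $$ (r, c) =
      (\<Sum>w\<in>{0..<n}. (if r = 0 \<and> w = 0 then a else 0) * (if w = 0 \<and> c = 0 then b else 0))"
    using rc by (simp add: corner_def scalar_prod_def)
  also have "\<dots> = (\<Sum>w\<in>{0..<n}. if w = 0 then (if r = 0 \<and> c = 0 then a * b else 0) else 0)"
    by (rule sum.cong) auto
  also have "\<dots> = corner n (a * b) $$ (r, c)"
    using assms rc by (simp add: corner_def)
  finally show "(corner n a * corner n b) $$ (r, c) = corner n (a * b) $$ (r, c)" .
qed (auto simp: corner_def)

lemma corner_one: "corner n 1 = mat_unit n 0 0"
  by (rule eq_matI) (auto simp: corner_def mat_unit_def)

locale mat_ring_hom =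
  fixes f :: "'a::ring_1 mat \<Rightarrow> 'a mat" and i j :: nat
  assumes i_pos: "0 < i" and j_pos: "0 < j"
    and hom: "f \<in> ring_hom (ring_mat TYPE('a) i ()) (ring_mat TYPE('a) j ())"
begin

lemma carrier: "A \<in> carrier_mat i i \<Longrightarrow> f A \<in> carrier_mat j j"
  using ring_hom_closed[OF hom] by (simp add: ring_mat_simps)

lemma add: "A \<in> carrier_mat i i \<Longrightarrow> B \<in> carrier_mat i i \<Longrightarrow> f (A + B) = f A + f B"
  using ring_hom_add[OF hom] by (simp add: ring_mat_simps)

lemma mult: "A \<in> carrier_mat i i \<Longrightarrow> B \<in> carrier_mat i i \<Longrightarrow> f (A * B) = f A * f B"
  using ring_hom_mult[OF hom] by (simp add: ring_mat_simps)

lemma one: "f (1\<^sub>m i) = 1\<^sub>m j"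
  using ring_hom_one[OF hom] by (simp add: ring_mat_simps)

lemma zero: "f (0\<^sub>m i i) = 0\<^sub>m j j"
  using ring_hom_zero[OF hom ring_ring_mat ring_ring_mat] by (simp add: ring_mat_simps)

lemma idem_mat_image: "A \<in> carrier_mat i i \<Longrightarrow> A * A = A \<Longrightarrow> idem_mat (f A)"
  unfolding idem_mat_def using carrier mult by (metis carrier_matD(1))

sublocale corner: nonunital_mat_hom "\<lambda>a. f (corner i a)" j
  by unfold_locales (simp_all add: j_pos carrier corner_add add corner_mult[OF i_pos, symmetric] mult)

text \<open>\<open>E\<^sub>k\<^sub>k = E\<^sub>k\<^sub>0 E\<^sub>0\<^sub>k\<close> and \<open>E\<^sub>0\<^sub>0 = E\<^sub>0\<^sub>k E\<^sub>k\<^sub>0\<close>, so the images of the diagonal matrix units are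
  pairwise equivalent.\<close>

lemma abs_idem_class_image_mat_unit:
  assumes k: "k < i"
  shows "abs_idem_class (f (mat_unit i k k)) = abs_idem_class (f (mat_unit i 0 0))"
proof -
  have "f (mat_unit i k 0) * f (mat_unit i 0 k) = f (mat_unit i k k)"
    using mat_unit_mult[OF i_pos, of k k, where 'a='a] by (simp add: mult[symmetric])
  moreover have "f (mat_unit i 0 k) * f (mat_unit i k 0) = f (mat_unit i 0 0)"
    using mat_unit_mult[OF k, of 0 0, where 'a='a] by (simp add: mult[symmetric])
  moreover have "idem_mat (f (mat_unit i k k))" "idem_mat (f (mat_unit i 0 0))"
    using mat_unit_mult[OF k, of k k, where 'a='a] mat_unit_mult[OF i_pos, of 0 0, where 'a='a]
    by (auto intro: idem_mat_image)
  ultimately show ?thesis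
    using carrier[of "mat_unit i k 0"] carrier[of "mat_unit i 0 k"] carrier[of "mat_unit i k k"]
      carrier[of "mat_unit i 0 0"]
    by (simp add: abs_idem_class_eq_iff mvn_equivI)
qed

text \<open>The identity of \<open>M\<^sub>i(R)\<close> is the sum of the orthogonal idempotents \<open>E\<^sub>0\<^sub>0, \<dots>, E\<^sub>i\<^sub>-\<^sub>1\<^sub>,\<^sub>i\<^sub>-\<^sub>1\<close>;
  its partial sums are diagonal.\<close>

lemma abs_idem_class_image_diag_prefix:
  "k \<le> i \<Longrightarrow>
    abs_idem_class (f (mat_diag i (\<lambda>r. if r < k then 1 else 0))) = (\<Sum>_<k. abs_idem_class (f (mat_unit i 0 0)))"
proof (induction k)
  case 0
  have "mat_diag i (\<lambda>r. if r < 0 then 1 else 0) = (0\<^sub>m i i :: 'a mat)"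
    by (rule eq_matI) (auto simp: mat_diag_def)
  then show ?case
    by (simp add: zero abs_idem_class_zero_mat)
next
  case (Suc k)
  define D where "D = mat_diag i (\<lambda>r. if r < k then 1 else (0::'a))"
  have k: "k < i"
    using Suc.prems by simp
  have split: "mat_diag i (\<lambda>r. if r < Suc k then 1 else 0) = D + mat_unit i k k"
    unfolding D_def mat_unit_diag by (rule eq_matI) (auto simp: mat_diag_def)
  have "D * D = D" "D * mat_unit i k k = 0\<^sub>m i i" "mat_unit i k k * D = 0\<^sub>m i i"
    unfolding D_def mat_unit_diag mat_diag_diag by (auto intro!: eq_matI simp: mat_diag_def)
  moreover have "mat_unit i k k * mat_unit i k k = (mat_unit i k k :: 'a mat)"
    by (rule mat_unit_mult[OF k])
  ultimately have "abs_idem_class (f D + f (mat_unit i k k)) =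
      abs_idem_class (f D) + abs_idem_class (f (mat_unit i k k))"
    using abs_idem_class_add_orthogonal[OF carrier carrier, of D "mat_unit i k k"]
    by (simp add: D_def mult[symmetric] zero)
  then show ?case
    using Suc.IH k abs_idem_class_image_mat_unit[OF k] by (simp add: split add D_def)
qed

lemma abs_idem_class_image_corner_one:
  "(\<Sum>_<i. abs_idem_class (f (corner i 1))) = (\<Sum>_<j. abs_idem_class (1\<^sub>m 1 :: 'a mat))"
proof -
  have "mat_diag i (\<lambda>r. if r < i then 1 else 0) = (1\<^sub>m i :: 'a mat)"
    by (rule eq_matI) (auto simp: mat_diag_def)
  then have "(\<Sum>_<i. abs_idem_class (f (corner i 1))) = abs_idem_class (f (1\<^sub>m i))"
    using abs_idem_class_image_diag_prefix[of i] by (simp add: corner_one)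
  also have "\<dots> = (\<Sum>_<j. abs_idem_class (1\<^sub>m 1 :: 'a mat))"
    unfolding one by (rule abs_idem_class_one_mat)
  finally show ?thesis .
qed

lemma K0_map_unit_pow:
  "corner.K0_map (K0_unit TYPE('a) [^]\<^bsub>K0 TYPE('a)\<^esub> i) = K0_unit TYPE('a) [^]\<^bsub>K0 TYPE('a)\<^esub> j"
proof -
  interpret K0: comm_group "K0 TYPE('a)"
    by (rule comm_group_K0)
  have image: "(f (corner i 1), 0\<^sub>m 0 0) \<in> K0_pairs TYPE('a)"
    using corner.idem_mat_amplify[OF idem_mat_one[of 1]] unfolding corner.amplify_one_mat
    by (simp add: K0_pairs_iff idem_mat_zero)
  obtain q where q: "q \<in> K0_pairs TYPE('a)"
    "K0_cls (f (corner i 1), 0\<^sub>m 0 0) [^]\<^bsub>K0 TYPE('a)\<^esub> i = K0_cls q"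
    "pair_classes q = (\<Sum>_<i. pair_classes (f (corner i 1), 0\<^sub>m 0 0))"
    by (rule K0_cls_nat_pow[OF image])
  obtain q' where q': "q' \<in> K0_pairs TYPE('a)"
    "K0_cls (1\<^sub>m 1, 0\<^sub>m 0 0) [^]\<^bsub>K0 TYPE('a)\<^esub> j = K0_cls q'"
    "pair_classes q' = (\<Sum>_<j. pair_classes (1\<^sub>m 1 :: 'a mat, 0\<^sub>m 0 0))"
    by (rule K0_cls_nat_pow[OF unit_in_K0_pairs])
  have "pair_classes q = pair_classes q'"
    using q(3) q'(3) abs_idem_class_image_corner_one
    by (simp add: pair_classes_def sum_prod abs_idem_class_zero)
  then have "K0_cls q = K0_cls q'"
    using q(1) q'(1) by (simp add: K0_cls_eq_iff grothendieck_eq_refl)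
  moreover have "corner.K0_map (K0_unit TYPE('a) [^]\<^bsub>K0 TYPE('a)\<^esub> i) = K0_cls (f (corner i 1), 0\<^sub>m 0 0) [^]\<^bsub>K0 TYPE('a)\<^esub> i"
    using hom_nat_pow[OF corner.K0_map_hom K0_unit_in_carrier K0.is_group K0.is_group] corner.K0_map_unit by simp
  ultimately show ?thesis
    using q(2) q'(2) by (simp add: K0_unit_def)
qed

end

section \<open>Endomorphisms of finitely generated abelian groups\<close>

lemma common_denominator:
  fixes X :: "rat set"
  assumes "finite X"
  obtains d :: int where "0 < d" "\<And>x. x \<in> X \<Longrightarrow> of_int d * x \<in> \<int>"
proof
  define d where "d = (\<Prod>x\<in>X. snd (quotient_of x))"
  show "0 < d"
    unfolding d_def using quotient_of_denom_pos' by (intro prod_pos) auto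
  fix x assume x: "x \<in> X"
  obtain a b where ab: "quotient_of x = (a, b)"
    by (cases "quotient_of x")
  define e where "e = (\<Prod>y\<in>X - {x}. snd (quotient_of y))"
  have "d = b * e"
    unfolding d_def e_def using assms x ab by (simp add: prod.remove)
  then have "of_int d * x = of_int (a * e)"
    using quotient_of_div[OF ab] quotient_of_denom_pos[OF ab] by (simp add: field_simps)
  then show "of_int d * x \<in> \<int>"
    by (simp only: Ints_of_int)
qed

context comm_group
begin

definition rat_hom_on :: "('a \<Rightarrow> rat) \<Rightarrow> 'a set \<Rightarrow> bool" where
  "rat_hom_on \<psi> H \<longleftrightarrow> (\<forall>a\<in>H. \<forall>b\<in>H. \<psi> (a \<otimes> b) = \<psi> a + \<psi> b)"

lemma rat_hom_on_one:
  assumes "rat_hom_on \<psi> H" "subgroup H G"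
  shows "\<psi> \<one> = 0"
  using assms subgroup.one_closed[OF assms(2)] unfolding rat_hom_on_def by (metis add_cancel_left_left l_one one_closed)

lemma rat_hom_on_inv:
  assumes "rat_hom_on \<psi> H" "subgroup H G" "a \<in> H"
  shows "\<psi> (inv a) = - \<psi> a"
proof -
  have "\<psi> (a \<otimes> inv a) = \<psi> a + \<psi> (inv a)"
    using assms subgroup.m_inv_closed[OF assms(2,3)] unfolding rat_hom_on_def by blast
  then show ?thesis
    using assms subgroup.subset rat_hom_on_one[OF assms(1,2)] by fastforce
qed

lemma rat_hom_on_nat_pow:
  assumes "rat_hom_on \<psi> H" "subgroup H G" "a \<in> H"
  shows "\<psi> (a [^] (n::nat)) = of_nat n * \<psi> a"
proof (induction n)
  case 0
  then show ?case using rat_hom_on_one[OF assms(1,2)] by simp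
next
  case (Suc n)
  have "a [^] n \<in> H"
    using subgroup_int_pow_closed[OF assms(2,3), of "int n"] by (simp add: int_pow_int)
  then have "\<psi> (a [^] n \<otimes> a) = \<psi> (a [^] n) + \<psi> a"
    using assms(1,3) unfolding rat_hom_on_def by blast
  then show ?case
    using Suc by (simp add: algebra_simps)
qed

lemma rat_hom_on_int_pow:
  assumes "rat_hom_on \<psi> H" "subgroup H G" "a \<in> H"
  shows "\<psi> (a [^] (k::int)) = of_int k * \<psi> a"
proof (cases "k \<ge> 0")
  case True
  then obtain n where "k = int n"
    by (intro that[of "nat k"]) auto
  then show ?thesis
    using rat_hom_on_nat_pow[OF assms] by (simp add: int_pow_int)
next
  case False
  then obtain n where n: "k = - int n"
    by (intro that[of "nat (- k)"]) auto
  have "a \<in> carrier G"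
    using assms subgroup.subset by blast
  moreover have "a [^] n \<in> H"
    using subgroup_int_pow_closed[OF assms(2,3), of "int n"] by (simp add: int_pow_int)
  ultimately show ?thesis
    using n rat_hom_on_nat_pow[OF assms] rat_hom_on_inv[OF assms(1,2)] by (simp add: int_pow_neg_int)
qed

lemma subgroup_mult_int_pows:
  assumes H: "subgroup H G" and g: "g \<in> carrier G"
  shows "subgroup {h \<otimes> g [^] (k::int) | h k. h \<in> H} G"
proof (rule subgroupI)
  have Hc: "H \<subseteq> carrier G"
    using H by (rule subgroup.subset)
  then show "{h \<otimes> g [^] (k::int) | h k. h \<in> H} \<subseteq> carrier G"
    using g by auto
  show "{h \<otimes> g [^] (k::int) | h k. h \<in> H} \<noteq> {}"
    using subgroup.one_closed[OF H] by blast
  fix a b assume "a \<in> {h \<otimes> g [^] (k::int) | h k. h \<in> H}" "b \<in> {h \<otimes> g [^] (k::int) | h k. h \<in> H}"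
  then obtain h h' and k k' :: int where h: "h \<in> H" "a = h \<otimes> g [^] k" and h': "h' \<in> H" "b = h' \<otimes> g [^] k'"
    by blast
  have hc: "h \<in> carrier G" "h' \<in> carrier G"
    using h(1) h'(1) Hc by auto
  have "inv h \<in> H" "h \<otimes> h' \<in> H"
    using h h' H by (simp_all add: subgroup.m_inv_closed subgroup.m_closed)
  moreover have "inv a = inv h \<otimes> g [^] (- k)"
    using hc h(2) g by (simp add: inv_mult int_pow_neg)
  moreover have "a \<otimes> b = (h \<otimes> h') \<otimes> g [^] (k + k')"
    using hc h(2) h'(2) g by (simp add: int_pow_mult m_ac)
  ultimately show "inv a \<in> {h \<otimes> g [^] (k::int) | h k. h \<in> H}" "a \<otimes> b \<in> {h \<otimes> g [^] (k::int) | h k. h \<in> H}"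
    by auto
qed

lemma generate_insert_eq:
  assumes A: "A \<subseteq> carrier G" and g: "g \<in> carrier G"
  shows "generate G (insert g A) = {h \<otimes> g [^] (k::int) | h k. h \<in> generate G A}"
proof
  have HA: "subgroup (generate G A) G"
    using A by (rule generate_is_subgroup)
  have "insert g A \<subseteq> {h \<otimes> g [^] (k::int) | h k. h \<in> generate G A}"
  proof
    fix y assume "y \<in> insert g A"
    then consider "y = g" | "y \<in> A"
      by blast
    then show "y \<in> {h \<otimes> g [^] (k::int) | h k. h \<in> generate G A}"
    proof cases
      case 1
      then have "y = \<one> \<otimes> g [^] (1::int)"
        using g by simp
      then show ?thesis
        using subgroup.one_closed[OF HA] by blast
    next
      case 2
      then have "y = y \<otimes> g [^] (0::int)"
        using A by auto
      then show ?thesis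
        using 2 generate.incl[of y A G] by blast
    qed
  qed
  then show "generate G (insert g A) \<subseteq> {h \<otimes> g [^] (k::int) | h k. h \<in> generate G A}"
    by (rule generate_subgroup_incl[OF _ subgroup_mult_int_pows[OF HA g]])
next
  have HB: "subgroup (generate G (insert g A)) G"
    using A g by (intro generate_is_subgroup) auto
  show "{h \<otimes> g [^] (k::int) | h k. h \<in> generate G A} \<subseteq> generate G (insert g A)"
  proof clarify
    fix h and k :: int assume "h \<in> generate G A"
    moreover have "generate G A \<subseteq> generate G (insert g A)"
      by (rule mono_generate) auto
    moreover have "g [^] k \<in> generate G (insert g A)"
      using subgroup_int_pow_closed[OF HB generate.incl[of g "insert g A" G]] by simp
    ultimately show "h \<otimes> g [^] k \<in> generate G (insert g A)"
      using HB by (auto simp: subgroup.m_closed)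
  qed
qed

lemma int_pow_in_subgroup_imp_nat_pow:
  assumes H: "subgroup H G" and g: "g \<in> carrier G" and gk: "g [^] (k::int) \<in> H"
  shows "g [^] nat \<bar>k\<bar> \<in> H"
proof -
  have "g [^] int (nat \<bar>k\<bar>) \<in> H"
  proof (cases "k \<ge> 0")
    case True
    then show ?thesis using gk by simp
  next
    case False
    then have "g [^] int (nat \<bar>k\<bar>) = inv (g [^] k)"
      using int_pow_neg[OF g, of k] by simp
    then show ?thesis
      using subgroup.m_inv_closed[OF H gk] by simp
  qed
  then show ?thesis
    by (simp only: int_pow_int)
qed

text \<open>A value \<open>c\<close> for \<open>\<psi> g\<close> compatible with the powers of \<open>g\<close> already in \<open>H\<close>: if \<open>g\<^sup>m \<in> H\<close>
  for some \<open>m > 0\<close>, then \<open>c = \<psi>(g\<^sup>m) / m\<close>, because \<open>(g\<^sup>k)\<^sup>m = (g\<^sup>m)\<^sup>k\<close>.\<close>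

lemma ex_rat_hom_on_value:
  assumes H: "subgroup H G" and g: "g \<in> carrier G" and \<psi>: "rat_hom_on \<psi> H"
  obtains c where "\<And>k::int. g [^] k \<in> H \<Longrightarrow> \<psi> (g [^] k) = of_int k * c"
proof (cases "\<exists>m::nat. 0 < m \<and> g [^] m \<in> H")
  case True
  then obtain m :: nat where m: "0 < m" "g [^] m \<in> H"
    by blast
  show ?thesis
  proof
    fix k :: int assume gk: "g [^] k \<in> H"
    have gm: "g [^] int m \<in> H"
      using m by (simp add: int_pow_int)
    have "(g [^] k) [^] int m = (g [^] int m) [^] k"
      using g by (simp add: int_pow_pow mult.commute)
    then have "of_nat m * \<psi> (g [^] k) = of_int k * \<psi> (g [^] m)"
      using rat_hom_on_int_pow[OF \<psi> H gk, of "int m"] rat_hom_on_int_pow[OF \<psi> H gm, of k]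
      by (simp add: int_pow_int)
    then show "\<psi> (g [^] k) = of_int k * (\<psi> (g [^] m) / of_nat m)"
      using m(1) by (simp add: field_simps)
  qed
next
  case False
  show ?thesis
  proof
    fix k :: int assume "g [^] k \<in> H"
    then have "g [^] nat \<bar>k\<bar> \<in> H"
      by (rule int_pow_in_subgroup_imp_nat_pow[OF H g])
    with False have "k = 0"
      by (metis zero_less_nat_eq zero_less_abs_iff)
    then show "\<psi> (g [^] k) = of_int k * 0"
      using rat_hom_on_one[OF \<psi> H] by simp
  qed
qed

text \<open>The extension \<open>h g\<^sup>k \<mapsto> \<psi> h + k c\<close> of \<open>\<psi>\<close> from \<open>H\<close> to \<open>H\<langle>g\<rangle>\<close>; it is well defined only if
  \<open>\<psi>(g\<^sup>k) = k c\<close> whenever \<open>g\<^sup>k \<in> H\<close>.\<close>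

definition rat_hom_ext :: "('a \<Rightarrow> rat) \<Rightarrow> 'a set \<Rightarrow> 'a \<Rightarrow> rat \<Rightarrow> 'a \<Rightarrow> rat" where
  "rat_hom_ext \<psi> H g c y = (SOME v. \<exists>h\<in>H. \<exists>k::int. y = h \<otimes> g [^] k \<and> v = \<psi> h + of_int k * c)"

lemma rat_hom_ext_mult_int_pow:
  assumes H: "subgroup H G" and g: "g \<in> carrier G" and \<psi>: "rat_hom_on \<psi> H"
    and c: "\<And>k::int. g [^] k \<in> H \<Longrightarrow> \<psi> (g [^] k) = of_int k * c" and h: "h \<in> H"
  shows "rat_hom_ext \<psi> H g c (h \<otimes> g [^] k) = \<psi> h + of_int k * c"
proof -
  have well_defined: "\<psi> h + of_int k * c = \<psi> h' + of_int k' * c"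
    if h': "h' \<in> H" and eq: "h \<otimes> g [^] k = h' \<otimes> g [^] k'" for h' k'
  proof -
    have hc: "h \<in> carrier G" "h' \<in> carrier G"
      using h h' subgroup.subset[OF H] by auto
    then have "g [^] k = inv h \<otimes> (h' \<otimes> g [^] k')"
      using inv_solve_left[of "g [^] k" h "h' \<otimes> g [^] k'"] g eq by simp
    then have "g [^] (k - k') = inv h \<otimes> h'"
      using hc g by (simp add: int_pow_diff m_assoc)
    moreover have "inv h \<otimes> h' \<in> H" "\<psi> (inv h \<otimes> h') = - \<psi> h + \<psi> h'"
      using \<psi> h h' rat_hom_on_inv[OF \<psi> H h] subgroup.m_inv_closed[OF H h] subgroup.m_closed[OF H]
      unfolding rat_hom_on_def by simp_all
    ultimately have "of_int (k - k') * c = - \<psi> h + \<psi> h'"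
      using c by metis
    then show ?thesis
      by (simp add: algebra_simps)
  qed
  have "\<exists>v. \<exists>h'\<in>H. \<exists>k'::int. h \<otimes> g [^] k = h' \<otimes> g [^] k' \<and> v = \<psi> h' + of_int k' * c"
    using h by blast
  from someI_ex[OF this] obtain h' k' where "h' \<in> H" "h \<otimes> g [^] k = h' \<otimes> g [^] k'"
    "rat_hom_ext \<psi> H g c (h \<otimes> g [^] k) = \<psi> h' + of_int k' * c"
    unfolding rat_hom_ext_def by blast
  then show ?thesis
    using well_defined by simp
qed

lemma rat_hom_on_extend:
  assumes A: "A \<subseteq> carrier G" and g: "g \<in> carrier G" and \<psi>: "rat_hom_on \<psi> (generate G A)"
    and c: "\<And>k::int. g [^] k \<in> generate G A \<Longrightarrow> \<psi> (g [^] k) = of_int k * c"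
  obtains \<psi>' where "rat_hom_on \<psi>' (generate G (insert g A))" "\<And>h. h \<in> generate G A \<Longrightarrow> \<psi>' h = \<psi> h"
    "\<psi>' g = c"
proof
  let ?H = "generate G A" and ?\<psi>' = "rat_hom_ext \<psi> (generate G A) g c"
  have H: "subgroup ?H G"
    using A by (rule generate_is_subgroup)
  have \<psi>'_eq: "?\<psi>' (h \<otimes> g [^] k) = \<psi> h + of_int k * c" if "h \<in> ?H" for h k
    by (rule rat_hom_ext_mult_int_pow[OF H g \<psi> _ that]) (rule c)
  show "rat_hom_on ?\<psi>' (generate G (insert g A))"
    unfolding rat_hom_on_def generate_insert_eq[OF A g]
  proof clarify
    fix h h' and k k' :: int assume h: "h \<in> ?H" and h': "h' \<in> ?H"
    have "h \<in> carrier G" "h' \<in> carrier G"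
      using h h' subgroup.subset[OF H] by auto
    then have "h \<otimes> g [^] k \<otimes> (h' \<otimes> g [^] k') = (h \<otimes> h') \<otimes> g [^] (k + k')"
      using g by (simp add: int_pow_mult m_ac)
    moreover have "h \<otimes> h' \<in> ?H"
      using h h' H by (simp add: subgroup.m_closed)
    moreover have "\<psi> (h \<otimes> h') = \<psi> h + \<psi> h'"
      using \<psi> h h' unfolding rat_hom_on_def by blast
    ultimately show "?\<psi>' (h \<otimes> g [^] k \<otimes> (h' \<otimes> g [^] k')) = ?\<psi>' (h \<otimes> g [^] k) + ?\<psi>' (h' \<otimes> g [^] k')"
      using h h' \<psi>'_eq by (simp add: algebra_simps)
  qed
  show "?\<psi>' h = \<psi> h" if h: "h \<in> ?H" for h
  proof -
    have "h = h \<otimes> g [^] (0::int)"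
      using h subgroup.subset[OF H] by auto
    then show ?thesis
      using \<psi>'_eq[OF h, of 0] by simp
  qed
  have "g = \<one> \<otimes> g [^] (1::int)"
    using g by simp
  then show "?\<psi>' g = c"
    using \<psi>'_eq[OF subgroup.one_closed[OF H], of 1] rat_hom_on_one[OF \<psi> H] by simp
qed

lemma ex_rat_hom_on_generate:
  assumes "finite S" "S \<subseteq> carrier G" and x: "x \<in> carrier G"
    and inf: "\<And>n::nat. 0 < n \<Longrightarrow> x [^] n \<noteq> \<one>"
  obtains \<psi> where "rat_hom_on \<psi> (generate G (insert x S))" "\<psi> x = 1"
  using assms(1,2)
proof (induction S arbitrary: thesis rule: finite_induct)
  case empty
  have "k = 0" if "x [^] k \<in> generate G {}" for k :: int
  proof -
    have "x [^] nat \<bar>k\<bar> \<in> generate G {}"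
      using int_pow_in_subgroup_imp_nat_pow[OF generate_is_subgroup x that] by simp
    then have "x [^] nat \<bar>k\<bar> = \<one>"
      by (simp only: generate_empty singleton_iff)
    then have "\<not> 0 < nat \<bar>k\<bar>"
      using inf[of "nat \<bar>k\<bar>"] by blast
    then show "k = 0"
      by simp
  qed
  then have "\<And>k::int. x [^] k \<in> generate G {} \<Longrightarrow> (\<lambda>_. 0) (x [^] k) = of_int k * (1::rat)"
    by simp
  moreover have "rat_hom_on (\<lambda>_. 0) (generate G {})"
    by (simp add: rat_hom_on_def)
  ultimately obtain \<psi> where "rat_hom_on \<psi> (generate G (insert x {}))" "\<psi> x = 1"
    using rat_hom_on_extend[of "{}" x "\<lambda>_. 0" 1] x by blast
  then show ?case
    by (rule empty.prems)
next
  case (insert s F)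
  obtain \<psi> where \<psi>: "rat_hom_on \<psi> (generate G (insert x F))" "\<psi> x = 1"
    using insert.IH insert.prems(2) by blast
  have A: "insert x F \<subseteq> carrier G" and s: "s \<in> carrier G"
    using insert.prems(2) x by auto
  obtain c where "\<And>k::int. s [^] k \<in> generate G (insert x F) \<Longrightarrow> \<psi> (s [^] k) = of_int k * c"
    using ex_rat_hom_on_value[OF generate_is_subgroup[OF A] s \<psi>(1)] by blast
  then obtain \<psi>' where \<psi>': "rat_hom_on \<psi>' (generate G (insert s (insert x F)))"
    "\<And>h. h \<in> generate G (insert x F) \<Longrightarrow> \<psi>' h = \<psi> h"
    using rat_hom_on_extend[OF A s \<psi>(1)] by blast
  have "\<psi>' x = 1"
    using \<psi>'(2)[OF generate.incl[of x "insert x F" G]] \<psi>(2) by simp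
  then show ?case
    using insert.prems(1) \<psi>'(1) by (simp add: insert_commute)
qed

lemma rat_hom_on_Ints_generate:
  assumes S: "S \<subseteq> carrier G" and \<psi>: "rat_hom_on \<psi> (carrier G)"
    and d: "\<And>s. s \<in> S \<Longrightarrow> of_int d * \<psi> s \<in> \<int>" and y: "y \<in> generate G S"
  shows "of_int d * \<psi> y \<in> \<int>"
  using y
proof (induction rule: generate.induct)
  case one
  then show ?case using rat_hom_on_one[OF \<psi> subgroup_self] by simp
next
  case (incl h)
  then show ?case by (rule d)
next
  case (inv h)
  then have "\<psi> (inv h) = - \<psi> h"
    using rat_hom_on_inv[OF \<psi> subgroup_self] S by blast
  then show ?case
    using d[OF inv] by (simp add: Ints_minus)
next
  case (eng h1 h2)
  then have "\<psi> (h1 \<otimes> h2) = \<psi> h1 + \<psi> h2"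
    using \<psi> generate_incl[OF S] unfolding rat_hom_on_def by blast
  then show ?case
    using eng.IH by (simp add: distrib_left)
qed

lemma rat_hom_bounded_denominator:
  assumes "finite S" "S \<subseteq> carrier G" and gen: "generate G S = carrier G"
    and \<psi>: "rat_hom_on \<psi> (carrier G)"
  obtains d :: int where "0 < d" "\<And>y. y \<in> carrier G \<Longrightarrow> of_int d * \<psi> y \<in> \<int>"
proof -
  obtain d :: int where d: "0 < d" "\<And>x. x \<in> \<psi> ` S \<Longrightarrow> of_int d * x \<in> \<int>"
    using common_denominator[of "\<psi> ` S"] assms(1) by blast
  show ?thesis
  proof (rule that[OF d(1)])
    fix y assume "y \<in> carrier G"
    then show "of_int d * \<psi> y \<in> \<int>"
      using rat_hom_on_Ints_generate[OF assms(2) \<psi>, of d y] d(2) gen by simp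
  qed
qed

lemma funpow_hom:
  assumes t: "t \<in> hom G G"
  shows "t ^^ n \<in> hom G G"
proof (induction n)
  case 0
  show ?case
    by (rule homI) simp_all
next
  case (Suc n)
  show ?case
  proof (rule homI)
    fix x assume "x \<in> carrier G"
    then show "(t ^^ Suc n) x \<in> carrier G"
      using hom_in_carrier[OF t] hom_in_carrier[OF Suc.IH] by simp
  next
    fix x y assume "x \<in> carrier G" "y \<in> carrier G"
    then show "(t ^^ Suc n) (x \<otimes> y) = (t ^^ Suc n) x \<otimes> (t ^^ Suc n) y"
      using hom_mult[OF t] hom_mult[OF Suc.IH] hom_in_carrier[OF Suc.IH] by simp
  qed
qed

lemma funpow_hom_pow_eq:
  assumes t: "t \<in> hom G G" and x: "x \<in> carrier G" and e: "t (x [^] (i::nat)) = x [^] (j::nat)"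
  shows "((t ^^ n) x) [^] (i ^ n) = x [^] (j ^ n)"
proof -
  have "(t ^^ n) (x [^] (i ^ n)) = x [^] (j ^ n)"
  proof (induction n)
    case 0
    then show ?case by simp
  next
    case (Suc n)
    have "(t ^^ Suc n) (x [^] (i ^ Suc n)) = t ((t ^^ n) ((x [^] (i ^ n)) [^] i))"
      using x by (simp add: nat_pow_pow mult.commute)
    also have "(t ^^ n) ((x [^] (i ^ n)) [^] i) = ((t ^^ n) (x [^] (i ^ n))) [^] i"
      using hom_nat_pow[OF funpow_hom[OF t] nat_pow_closed[OF x] is_group is_group] .
    also have "\<dots> = (x [^] i) [^] (j ^ n)"
      using Suc x by (simp add: nat_pow_pow mult.commute)
    also have "t \<dots> = (t (x [^] i)) [^] (j ^ n)"
      using hom_nat_pow[OF t nat_pow_closed[OF x] is_group is_group] .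
    also have "\<dots> = x [^] (j ^ Suc n)"
      using e x by (simp add: nat_pow_pow)
    finally show ?case .
  qed
  then show ?thesis
    using hom_nat_pow[OF funpow_hom[OF t] x is_group is_group] by simp
qed

text \<open>Fix \<open>\<psi> : G \<rightarrow> \<rat>\<close> with \<open>\<psi> x = 1\<close> and denominators bounded by \<open>d\<close>. Applying \<open>\<psi>\<close> to
  \<open>t\<^sup>n(x)\<^bsup>i\<^sup>n\<^esup> = x\<^bsup>j\<^sup>n\<^esup>\<close> gives \<open>i\<^sup>n \<psi>(t\<^sup>n x) = j\<^sup>n\<close>, where \<open>d \<psi>(t\<^sup>n x)\<close> is an integer.\<close>

lemma endomorphism_pow_dvd:
  assumes S: "finite S" "S \<subseteq> carrier G" "generate G S = carrier G" and x: "x \<in> carrier G"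
    and inf: "\<And>n::nat. 0 < n \<Longrightarrow> x [^] n \<noteq> \<one>"
  obtains d :: int where "0 < d"
    "\<And>t i j n. t \<in> hom G G \<Longrightarrow> t (x [^] (i::nat)) = x [^] (j::nat) \<Longrightarrow> int i ^ n dvd d * int j ^ n"
proof -
  obtain \<psi> where \<psi>: "rat_hom_on \<psi> (generate G (insert x S))" "\<psi> x = 1"
    using ex_rat_hom_on_generate[OF S(1,2) x inf] by blast
  have "generate G (insert x S) = carrier G"
    using S(2,3) x generate_incl[of "insert x S"] mono_generate[of S "insert x S"] by blast
  with \<psi>(1) have \<psi>G: "rat_hom_on \<psi> (carrier G)"
    by simp
  obtain d where d: "0 < d" "\<And>y. y \<in> carrier G \<Longrightarrow> of_int d * \<psi> y \<in> \<int>"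
    using rat_hom_bounded_denominator[OF S \<psi>G] by blast
  have "int i ^ n dvd d * int j ^ n" if t: "t \<in> hom G G" and e: "t (x [^] i) = x [^] j" for t i j n
  proof -
    have tnx: "(t ^^ n) x \<in> carrier G"
      using hom_in_carrier[OF funpow_hom[OF t] x] .
    have "of_nat (i ^ n) * \<psi> ((t ^^ n) x) = of_nat (j ^ n)"
      using funpow_hom_pow_eq[OF t x e, of n] \<psi>(2)
        rat_hom_on_nat_pow[OF \<psi>G subgroup_self tnx, of "i ^ n"] rat_hom_on_nat_pow[OF \<psi>G subgroup_self x, of "j ^ n"]
      by simp
    moreover obtain z where "of_int d * \<psi> ((t ^^ n) x) = of_int z"
      using d(2)[OF tnx] by (metis Ints_cases)
    ultimately have "of_int (int i ^ n * z) = (of_int (d * int j ^ n) :: rat)"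
      by (simp add: algebra_simps) (metis mult.assoc mult.commute of_nat_power)
    then have "int i ^ n * z = d * int j ^ n"
      by (simp only: of_int_eq_iff)
    then show ?thesis
      by (metis dvd_triv_left)
  qed
  with d(1) show ?thesis
    using that by blast
qed

end

lemma eq_one_if_pow_dvd:
  fixes a :: nat and d :: int
  assumes "0 < a" "0 < d" "\<And>n. int a ^ n dvd d"
  shows "a = 1"
proof (rule ccontr)
  assume "a \<noteq> 1"
  with assms(1) have "2 \<le> a"
    by simp
  have "(2::int) ^ nat d \<le> int a ^ nat d"
    using \<open>2 \<le> a\<close> by (intro power_mono) auto
  also have "\<dots> \<le> d"
    using assms(2,3) by (simp add: zdvd_imp_le)
  also have "\<dots> = int (nat d)"
    using assms(2) by simp
  also have "\<dots> < int (2 ^ nat d)"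
    by (simp only: of_nat_less_iff) (rule less_exp)
  finally show False
    by simp
qed

text \<open>Write \<open>i = a g\<close>, \<open>j = b g\<close> with \<open>a\<close>, \<open>b\<close> coprime: then \<open>a\<^sup>n\<close> divides \<open>d b\<^sup>n\<close>, hence \<open>d\<close>,
  for every \<open>n\<close>, so \<open>a = 1\<close>; symmetrically \<open>b = 1\<close>.\<close>

lemma eq_if_pow_dvd_mult_pow:
  fixes i j :: nat and d :: int
  assumes "0 < i" "0 < j" "0 < d" "\<And>n. int i ^ n dvd d * int j ^ n" "\<And>n. int j ^ n dvd d * int i ^ n"
  shows "i = j"
proof -
  have reduce: "int a ^ n dvd d"
    if "coprime a b" "\<And>n. int (a * g) ^ n dvd d * int (b * g) ^ n" "g \<noteq> 0" for a b g n
  proof -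
    have "int a ^ n * int g ^ n dvd (d * int b ^ n) * int g ^ n"
      using that(2)[of n] by (simp add: power_mult_distrib mult.assoc)
    then have "int a ^ n dvd d * int b ^ n"
      using that(3) by simp
    then show ?thesis
      using that(1) by (simp add: coprime_dvd_mult_left_iff)
  qed
  define g where "g = gcd i j"
  have g: "g \<noteq> 0"
    using assms(1) by (simp add: g_def)
  obtain a b where ab: "i = a * g" "j = b * g" "coprime a b"
    using gcd_coprime_exists[of i j] g unfolding g_def by blast
  have "a = 1"
    using eq_one_if_pow_dvd[OF _ assms(3) reduce[OF ab(3) _ g]] assms(1,4) ab(1,2) by (metis gr0I mult_0)
  moreover have "b = 1"
    using eq_one_if_pow_dvd[OF _ assms(3) reduce[OF ab(3)[THEN coprime_commute[THEN iffD1]] _ g]] assms(2,5) ab(1,2)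
    by (metis gr0I mult_0)
  ultimately show ?thesis
    using ab by simp
qed

theorem mainTheorem3:
  assumes "\<exists>S. finite S \<and> S \<subseteq> carrier (K0 TYPE('a::ring_1)) \<and>
              generate (K0 TYPE('a)) S = carrier (K0 TYPE('a))"
      and "\<forall>n::nat. 0 < n \<longrightarrow> K0_unit TYPE('a) [^]\<^bsub>K0 TYPE('a)\<^esub> n \<noteq> \<one>\<^bsub>K0 TYPE('a)\<^esub>"
  shows "invariant_matrix_number TYPE('a)"
  unfolding invariant_matrix_number_def
proof (intro allI impI notI)
  fix i j :: nat
  assume i: "0 < i" and j: "0 < j" and "i \<noteq> j"
    and "is_ring_iso (ring_mat TYPE('a) i ()) (ring_mat TYPE('a) j ())"
  then obtain f where f: "f \<in> ring_iso (ring_mat TYPE('a) i ()) (ring_mat TYPE('a) j ())"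
    unfolding is_ring_iso_def by blast
  interpret f: mat_ring_hom f i j
    using i j f by unfold_locales (simp_all add: ring_iso_def)
  interpret g: mat_ring_hom "inv_into (carrier (ring_mat TYPE('a) i ())) f" j i
    using i j ring_iso_set_sym[OF ring_ring_mat f] by unfold_locales (simp_all add: ring_iso_def)
  obtain S where "finite S" "S \<subseteq> carrier (K0 TYPE('a))" "generate (K0 TYPE('a)) S = carrier (K0 TYPE('a))"
    using assms(1) by blast
  then obtain d where "0 < d" and dvd: "\<And>t i j n. t \<in> hom (K0 TYPE('a)) (K0 TYPE('a)) \<Longrightarrow>
      t (K0_unit TYPE('a) [^]\<^bsub>K0 TYPE('a)\<^esub> (i::nat)) = K0_unit TYPE('a) [^]\<^bsub>K0 TYPE('a)\<^esub> (j::nat) \<Longrightarrow>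
      int i ^ n dvd d * int j ^ n"
    using comm_group.endomorphism_pow_dvd[OF comm_group_K0 _ _ _ K0_unit_in_carrier] assms(2) by blast
  have "\<And>n. int i ^ n dvd d * int j ^ n" "\<And>n. int j ^ n dvd d * int i ^ n"
    using dvd[OF f.corner.K0_map_hom f.K0_map_unit_pow] dvd[OF g.corner.K0_map_hom g.K0_map_unit_pow] by simp_all
  with i j \<open>0 < d\<close> have "i = j"
    by (rule eq_if_pow_dvd_mult_pow)
  with \<open>i \<noteq> j\<close> show False ..
qed

end
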